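(* Let $\{(\bar y^k,\bar z^k,\bar x^k)\}$ be the sequence generated by the HOT algorithm (defined in the context) with parameter $\sigma>0$ and initial point $w^0=(y^0,z^0,x^0)\in\mathbb R^{M_3}\times\mathbb R^N\times\mathbb R^N$, and write $\bar w^k=(\bar y^k,\bar z^k,\bar x^k)$. For any given tolerance $\varepsilon>0$, the HOT algorithm needs at most $$\frac1\varepsilon\Big(\frac{1+\sigma}{\sigma}\big(\|x^0-x^*\|+\sigma\|z^0-z^*\|\big)\Big)-1$$ iterations to return a solution to the equivalent optimal transport problem (P) such that the KKT residual satisfies $\|\mathcal R(\bar w^k)\|\le\varepsilon$, where $(x^*,z^* )$ is the limit point of the sequence $\{(\bar x^k,\bar z^k)\}$. In particular, the overall computational complexity of the HOT algorithm to achieve this accuracy, in terms of flops, is $$O\left(\Big(\frac{1+\sigma}{\sigma}\big(\|x^0-x^*\|+\sigma\|z^0-z^*\|\big)\Big)\frac{m^2n+mn^2}{\varepsilon}\right).$$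
   Context: Let $m,n$ be positive integers, $M=mn$, $M_3=3M-1$, $N=m^2n+mn^2$. Let $\mu^1,\mu^2\in\mathbb R^M$ be nonnegative vectors whose entries each sum to $1$ (histograms on an $m\times n$ grid, vectorized with the row index running fastest). $\mathbf 1_p$ is the all-ones vector in $\mathbb R^p$, $\mathbf 0_p$ the zero vector, $I_p$ the identity, $\otimes$ the Kronecker product, and $\bar I_p=[I_{p-1},\mathbf 0_{p-1}]\in\mathbb R^{(p-1)\times p}$. Define $A=\begin{bmatrix} A_1 & A_2 \\ A_3 & \mathbf 0 \\ \mathbf 0 & A_4 \end{bmatrix}\in\mathbb R^{M_3\times N}$ with $A_1=I_M\otimes\mathbf 1_m^\top\in\mathbb R^{M\times m^2n}$, $A_2=-\mathbf 1_n^\top\otimes I_M\in\mathbb R^{M\times mn^2}$, $A_3=I_n\otimes(\mathbf 1_m^\top\otimes I_m)\in\mathbb R^{M\times m^2n}$, and $A_4=\operatorname{diag}(\mathbf 1_n^\top\otimes I_m,\dots,\mathbf 1_n^\top\otimes I_m,\mathbf 1_n^\top\otimes\bar I_m)\in\mathbb R^{(M-1)\times mn^2}$ (block diagonal with $n$ blocks). The matrix $A$ has full row rank. Let $b=[\mathbf 0_M;\mu^1;\bar I_M\mu^2]\in\mathbb R^{M_3}$. Let $c=[c^1;c^2]\in\mathbb R^{m^2n}\times\mathbb R^{mn^2}$, where $c^1$ has entries $c^{(1)}_{i,k,j}=(k-i)^2$ ($1\le i,k\le m$, $1\le j\le n$, ordered with $i$ fastest, then $k$, then $j$) and $c^2$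 has entries $c^{(2)}_{k,j,l}=(j-l)^2$ ($1\le k\le m$, $1\le j,l\le n$, ordered with $k$ fastest, then $j$, then $l$). (P): $\min\{\langle c,x\rangle : Ax=b,\ x\in\mathbb R^N_+\}$ (an equivalent reduced form of the discrete optimal transport problem between $\mu^1$ and $\mu^2$ with squared Euclidean ground cost). Its dual is (D): $\min\{-\langle b,y\rangle+\delta_{\mathbb R^N_+}(z): A^\top y+z=c\}$, where $\delta_C$ is the indicator function of $C$. The KKT residual mapping is, for $w=(y,z,x)\in\mathbb R^{M_3}\times\mathbb R^N\times\mathbb R^N$, $$\mathcal R(w)=\begin{pmatrix}b-Ax\\ z-\Pi_{\mathbb R^N_+}(z-x)\\ c-A^\top y-z\end{pmatrix},$$ with $\Pi_{\mathbb R^N_+}$ the Euclidean projection onto $\mathbb R^N_+$; $\|\cdot\|$ is the Euclidean norm. For $\sigma>0$, $L_\sigma(y,z;x)=-\langle b,y\rangle+\delta_{\mathbb R^N_+}(z)+\frac\sigma2\|A^\top y+z-c+\frac1\sigma x\|^2-\frac1{2\sigma}\|x\|^2$. HOT algorithm: given $\sigma>0$ and $w^0=(y^0,z^0,x^0)$, for $k=0,1,2,\dots$ set $\bar y^k=\arg\min_{y\in\mathbb R^{M_3}}L_\sigma(y,z^k;x^k)$; $\bar x^k=x^k+\sigma(A^\top\bar y^k+z^k-c)$; $\bar z^k=\arg\min_{z\in\mathbb R^N}L_\sigma(\bar y^k,z;\bar x^k)$; and, with $w^k=(y^k,z^k,x^k)$ and $\bar w^k=(\bar y^k,\bar z^k,\bar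 x^k)$, $w^{k+1}=\frac1{k+2}w^0+\frac{k+1}{k+2}(2\bar w^k-w^k)$. It is known that $\{\bar w^k\}$ converges to a point $(y^*,z^*,x^* )$ with $(y^*,z^* )$ a solution of (D) and $x^*$ a solution of (P).
   Formalization: The flop bound has max(1, B/ε) in place of B/ε, B being the bracketed constant (one pass is needed even if B = 0); the iteration bound is rounded up to a natural number; the y-step minimizes L_σ without the indicator of z^k, which may be infinite. *)

theory Defs
  imports "Jordan_Normal_Form.Matrix" "HOL-Library.Extended_Real"
begin

definition vnorm :: "real vec \<Rightarrow> real" where
  "vnorm v = sqrt (v \<bullet> v)"

definition vtendsto :: "nat \<Rightarrow> (nat \<Rightarrow> real vec) \<Rightarrow> real vec \<Rightarrow> bool" where
  "vtendsto d v l \<longleftrightarrow> (\<forall>k. v k \<in> carrier_vec d) \<and> l \<in> carrier_vec d \<and>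
     (\<lambda>k. vnorm (v k - l)) \<longlonglongrightarrow> 0"

definition kron :: "real mat \<Rightarrow> real mat \<Rightarrow> real mat" (infixl \<open>\<otimes>\<^sub>k\<close> 70) where
  "A \<otimes>\<^sub>k B = mat (dim_row A * dim_row B) (dim_col A * dim_col B)
     (\<lambda>(i, j). A $$ (i div dim_row B, j div dim_col B) * B $$ (i mod dim_row B, j mod dim_col B))"

definition ones_row :: "nat \<Rightarrow> real mat" where
  "ones_row p = mat 1 p (\<lambda>_. 1)"

definition append_cols :: "real mat \<Rightarrow> real mat \<Rightarrow> real mat" (infixr \<open>@\<^sub>c\<close> 66) where
  "A @\<^sub>c B = mat (dim_row A) (dim_col A + dim_col B)
     (\<lambda>(i, j). if j < dim_col A then A $$ (i, j) else B $$ (i, j - dim_col A))"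

definition Ibar :: "nat \<Rightarrow> real mat" where
  "Ibar p = 1\<^sub>m (p - 1) @\<^sub>c 0\<^sub>m (p - 1) 1"

definition orthant :: "nat \<Rightarrow> real vec set" where
  "orthant d = {v \<in> carrier_vec d. \<forall>i<d. 0 \<le> v $ i}"

definition indicator_fun :: "real vec set \<Rightarrow> real vec \<Rightarrow> ereal" where
  "indicator_fun C v = (if v \<in> C then 0 else \<infinity>)"

definition eucl_proj :: "real vec set \<Rightarrow> real vec \<Rightarrow> real vec" where
  "eucl_proj C v = arg_min (\<lambda>u. vnorm (u - v)) (\<lambda>u. u \<in> C)"

definition dimM :: "nat \<Rightarrow> nat \<Rightarrow> nat" where
  "dimM m n = m * n"

definition dimM3 :: "nat \<Rightarrow> nat \<Rightarrow> nat" where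
  "dimM3 m n = 3 * dimM m n - 1"

definition dimN :: "nat \<Rightarrow> nat \<Rightarrow> nat" where
  "dimN m n = m^2 * n + m * n^2"

definition histogram :: "nat \<Rightarrow> nat \<Rightarrow> real vec \<Rightarrow> bool" where
  "histogram m n \<mu> \<longleftrightarrow> \<mu> \<in> orthant (dimM m n) \<and> (\<Sum>i<dimM m n. \<mu> $ i) = 1"

definition matA1 :: "nat \<Rightarrow> nat \<Rightarrow> real mat" where
  "matA1 m n = 1\<^sub>m (dimM m n) \<otimes>\<^sub>k ones_row m"

definition matA2 :: "nat \<Rightarrow> nat \<Rightarrow> real mat" where
  "matA2 m n = - (ones_row n \<otimes>\<^sub>k 1\<^sub>m (dimM m n))"

definition matA3 :: "nat \<Rightarrow> nat \<Rightarrow> real mat" where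
  "matA3 m n = 1\<^sub>m n \<otimes>\<^sub>k (ones_row m \<otimes>\<^sub>k 1\<^sub>m m)"

definition matA4 :: "nat \<Rightarrow> nat \<Rightarrow> real mat" where
  "matA4 m n = diag_block_mat
     (replicate (n - 1) (ones_row n \<otimes>\<^sub>k 1\<^sub>m m) @ [ones_row n \<otimes>\<^sub>k Ibar m])"

definition matA :: "nat \<Rightarrow> nat \<Rightarrow> real mat" where
  "matA m n =
     (matA1 m n @\<^sub>c matA2 m n) @\<^sub>r
     (matA3 m n @\<^sub>c 0\<^sub>m (dimM m n) (m * n^2)) @\<^sub>r
     (0\<^sub>m (dimM m n - 1) (m^2 * n) @\<^sub>c matA4 m n)"

definition vecb :: "nat \<Rightarrow> nat \<Rightarrow> real vec \<Rightarrow> real vec \<Rightarrow> real vec" where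
  "vecb m n \<mu>1 \<mu>2 = 0\<^sub>v (dimM m n) @\<^sub>v \<mu>1 @\<^sub>v (Ibar (dimM m n) *\<^sub>v \<mu>2)"

text \<open>With indices counted from 0, position \<open>i + m * (k + m * j)\<close> of \<open>c\<^sup>1\<close> holds
  \<open>(k - i)\<^sup>2\<close>, and position \<open>k + m * (j + n * l)\<close> of \<open>c\<^sup>2\<close> holds \<open>(j - l)\<^sup>2\<close>.\<close>

definition vecc :: "nat \<Rightarrow> nat \<Rightarrow> real vec" where
  "vecc m n =
     vec (m^2 * n) (\<lambda>t. (real (t div m mod m) - real (t mod m))^2) @\<^sub>v
     vec (m * n^2) (\<lambda>t. (real (t div m mod n) - real (t div (m * n)))^2)"

definition kkt_residual ::
  "nat \<Rightarrow> nat \<Rightarrow> real vec \<Rightarrow> real vec \<Rightarrow> real vec \<Rightarrow> real vec \<Rightarrow> real vec \<Rightarrow> real vec" where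
  "kkt_residual m n \<mu>1 \<mu>2 y z x =
     (vecb m n \<mu>1 \<mu>2 - matA m n *\<^sub>v x) @\<^sub>v
     (z - eucl_proj (orthant (dimN m n)) (z - x)) @\<^sub>v
     (vecc m n - transpose_mat (matA m n) *\<^sub>v y - z)"

text \<open>The augmented Lagrangian \<open>L\<^sub>\<sigma>(y, z; x)\<close> is the sum of its finite part and the indicator
  of the orthant at \<open>z\<close>. The indicator does not depend on \<open>y\<close>, so the minimisation over \<open>y\<close> is
  stated for the finite part alone: the Halpern iterate \<open>z\<^sup>k\<close> may lie outside the orthant, where
  \<open>L\<^sub>\<sigma>(\<cdot>, z\<^sup>k; x\<^sup>k)\<close> would be constantly \<open>\<infinity>\<close>.\<close>

definition aug_lagr_finite ::
  "nat \<Rightarrow> nat \<Rightarrow> real vec \<Rightarrow> real vec \<Rightarrow> real \<Rightarrow> real vec \<Rightarrow> real vec \<Rightarrow> real vec \<Rightarrow> real" where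
  "aug_lagr_finite m n \<mu>1 \<mu>2 \<sigma> y z x =
     - (vecb m n \<mu>1 \<mu>2 \<bullet> y)
     + \<sigma> / 2 * (vnorm (transpose_mat (matA m n) *\<^sub>v y + z - vecc m n + (1 / \<sigma>) \<cdot>\<^sub>v x))^2
     - 1 / (2 * \<sigma>) * (vnorm x)^2"

definition aug_lagr ::
  "nat \<Rightarrow> nat \<Rightarrow> real vec \<Rightarrow> real vec \<Rightarrow> real \<Rightarrow> real vec \<Rightarrow> real vec \<Rightarrow> real vec \<Rightarrow> ereal" where
  "aug_lagr m n \<mu>1 \<mu>2 \<sigma> y z x =
     ereal (aug_lagr_finite m n \<mu>1 \<mu>2 \<sigma> y z x) + indicator_fun (orthant (dimN m n)) z"

definition hot_sequence ::
  "nat \<Rightarrow> nat \<Rightarrow> real vec \<Rightarrow> real vec \<Rightarrow> real \<Rightarrow>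
   (nat \<Rightarrow> real vec) \<Rightarrow> (nat \<Rightarrow> real vec) \<Rightarrow> (nat \<Rightarrow> real vec) \<Rightarrow>
   (nat \<Rightarrow> real vec) \<Rightarrow> (nat \<Rightarrow> real vec) \<Rightarrow> (nat \<Rightarrow> real vec) \<Rightarrow> bool" where
  "hot_sequence m n \<mu>1 \<mu>2 \<sigma> y z x ybar zbar xbar \<longleftrightarrow>
     y 0 \<in> carrier_vec (dimM3 m n) \<and> z 0 \<in> carrier_vec (dimN m n) \<and>
     x 0 \<in> carrier_vec (dimN m n) \<and>
     (\<forall>k.
        is_arg_min (\<lambda>u. aug_lagr_finite m n \<mu>1 \<mu>2 \<sigma> u (z k) (x k))
          (\<lambda>u. u \<in> carrier_vec (dimM3 m n)) (ybar k) \<and>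
        xbar k = x k + \<sigma> \<cdot>\<^sub>v (transpose_mat (matA m n) *\<^sub>v ybar k + z k - vecc m n) \<and>
        is_arg_min (\<lambda>u. aug_lagr m n \<mu>1 \<mu>2 \<sigma> (ybar k) u (xbar k))
          (\<lambda>u. u \<in> carrier_vec (dimN m n)) (zbar k) \<and>
        y (Suc k) = (1 / real (k + 2)) \<cdot>\<^sub>v y 0
          + (real (k + 1) / real (k + 2)) \<cdot>\<^sub>v (2 \<cdot>\<^sub>v ybar k - y k) \<and>
        z (Suc k) = (1 / real (k + 2)) \<cdot>\<^sub>v z 0
          + (real (k + 1) / real (k + 2)) \<cdot>\<^sub>v (2 \<cdot>\<^sub>v zbar k - z k) \<and>
        x (Suc k) = (1 / real (k + 2)) \<cdot>\<^sub>v x 0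
          + (real (k + 1) / real (k + 2)) \<cdot>\<^sub>v (2 \<cdot>\<^sub>v xbar k - x k))"

definition hot_run ::
  "nat \<Rightarrow> nat \<Rightarrow> real vec \<Rightarrow> real vec \<Rightarrow> real \<Rightarrow>
   (nat \<Rightarrow> real vec) \<Rightarrow> (nat \<Rightarrow> real vec) \<Rightarrow> (nat \<Rightarrow> real vec) \<Rightarrow>
   (nat \<Rightarrow> real vec) \<Rightarrow> (nat \<Rightarrow> real vec) \<Rightarrow> (nat \<Rightarrow> real vec) \<Rightarrow>
   real vec \<Rightarrow> real vec \<Rightarrow> bool" where
  "hot_run m n \<mu>1 \<mu>2 \<sigma> y z x ybar zbar xbar xstar zstar \<longleftrightarrow>
     histogram m n \<mu>1 \<and> histogram m n \<mu>2 \<and> 0 < \<sigma> \<and>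
     hot_sequence m n \<mu>1 \<mu>2 \<sigma> y z x ybar zbar xbar \<and>
     vtendsto (dimN m n) xbar xstar \<and> vtendsto (dimN m n) zbar zstar"

definition hot_const :: "real \<Rightarrow> real vec \<Rightarrow> real vec \<Rightarrow> real vec \<Rightarrow> real vec \<Rightarrow> real" where
  "hot_const \<sigma> x0 z0 xstar zstar =
     (1 + \<sigma>) / \<sigma> * (vnorm (x0 - xstar) + \<sigma> * vnorm (z0 - zstar))"

text \<open>The model is a real random access machine. Straight-line code acts on real registers; its
  instructions load a natural number or apply one arithmetic operation, and each is charged as
  one flop. A program runs its initial code once and then repeats its body until the test register
  is nonpositive after a pass; that comparison is charged as one more flop per pass. Register
  addresses are fixed in the code, so index computations are free.\<close>

datatype arith_op = Plus | Minus | Times | Divide | Maximum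

datatype instr = Const nat nat | Arith arith_op nat nat nat

fun apply_op :: "arith_op \<Rightarrow> real \<Rightarrow> real \<Rightarrow> real" where
  "apply_op Plus a b = a + b"
| "apply_op Minus a b = a - b"
| "apply_op Times a b = a * b"
| "apply_op Divide a b = a / b"
| "apply_op Maximum a b = max a b"

fun exec_instr :: "instr \<Rightarrow> (nat \<Rightarrow> real) \<Rightarrow> nat \<Rightarrow> real" where
  "exec_instr (Const d c) r = r(d := real c)"
| "exec_instr (Arith f d s t) r = r(d := apply_op f (r s) (r t))"

definition exec :: "instr list \<Rightarrow> (nat \<Rightarrow> real) \<Rightarrow> nat \<Rightarrow> real" where
  "exec is = fold exec_instr is"

datatype loop_prog = Loop (initial: "instr list") (body: "instr list")
  (test_reg: nat) (out_regs: "nat list")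

definition load :: "real list \<Rightarrow> nat \<Rightarrow> real" where
  "load inp i = (if i < length inp then inp ! i else 0)"

definition loop_state :: "loop_prog \<Rightarrow> real list \<Rightarrow> nat \<Rightarrow> nat \<Rightarrow> real" where
  "loop_state P inp k = (exec (body P) ^^ Suc k) (exec (initial P) (load inp))"

definition loop_output :: "loop_prog \<Rightarrow> real list \<Rightarrow> nat \<Rightarrow> real list" where
  "loop_output P inp k = map (loop_state P inp k) (out_regs P)"

definition halts_after :: "loop_prog \<Rightarrow> real list \<Rightarrow> nat \<Rightarrow> bool" where
  "halts_after P inp k \<longleftrightarrow>
     loop_state P inp k (test_reg P) \<le> 0 \<and> (\<forall>j<k. 0 < loop_state P inp j (test_reg P))"

text \<open>Passes are counted from 0, so halting after pass \<open>k\<close> means \<open>k + 1\<close> executed passes.\<close>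

definition loop_flops :: "loop_prog \<Rightarrow> nat \<Rightarrow> nat" where
  "loop_flops P k = length (initial P) + (k + 1) * (length (body P) + 1)"

definition hot_input ::
  "real \<Rightarrow> real \<Rightarrow> real vec \<Rightarrow> real vec \<Rightarrow> real vec \<Rightarrow> real vec \<Rightarrow> real vec \<Rightarrow> real list" where
  "hot_input \<sigma> \<epsilon> \<mu>1 \<mu>2 y0 z0 x0 =
     [\<sigma>, \<epsilon>] @ list_of_vec (\<mu>1 @\<^sub>v \<mu>2 @\<^sub>v y0 @\<^sub>v z0 @\<^sub>v x0)"

end

theory Submission
  imports Defs "HOL-Analysis.L2_Norm"
begin

text \<open>Put \<open>u\<^sub>k = x\<^sup>k + \<sigma> z\<^sup>k\<close>. One pass of the algorithm depends on \<open>u\<^sub>k\<close> only, and the map taking \<open>u\<^sub>k\<close>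
  to the same combination of the barred iterates is the firmly nonexpansive Douglas-Rachford map.
  So the algorithm is a Halpern iteration in \<open>u\<close>, and with \<open>g\<^sub>k\<close> the difference of the two
  combinations, Lieder's potential gives \<open>(k + 1) \<parallel>g\<^sub>k\<parallel>\<^sup>2 \<le> \<langle>g\<^sub>k, u\<^sub>0 - ubar\<^sub>k\<rangle>\<close>. As the barred iterates
  converge, \<open>g\<^sub>k\<close> tends to \<open>0\<close>; passing to the limit in the firm nonexpansiveness inequality then
  gives \<open>(k + 1) \<parallel>g\<^sub>k\<parallel> \<le> \<parallel>u\<^sub>0 - u\<^sup>*\<parallel>\<close> without solving the fixed point equation. Primal feasibility
  is exact and the dual residual is \<open>g\<^sub>k / \<sigma>\<close>, which bounds the KKT residual by
  \<open>(1 + \<sigma>) / \<sigma> \<parallel>g\<^sub>k\<parallel>\<close>. For the complexity, \<open>A A\<^sup>T y = r\<close> has a closed-form solution with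
  \<open>O(m n)\<close> operations beyond forming \<open>r\<close>, so a pass costs \<open>O(m\<^sup>2 n + m n\<^sup>2)\<close>.\<close>

section \<open>Halpern iteration of a firmly nonexpansive map\<close>

text \<open>The bar iterates are given only as minimisers, so each has to be made explicit.
  Stationarity in y says that \<open>xbar k\<close> is feasible, which makes it the projection of
  u_k - \<sigma> c onto the affine set A x = b; minimising over z is a projection onto the orthant.
  Both projections are firmly nonexpansive and the combined step inherits this. Convergence of the
  bar iterates replaces a fixed point: as g_j tends to 0, the inequality between passes k and j
  becomes the one that a fixed point would give. The program has to reproduce \<open>ybar k\<close>
  exactly, so the normal equations must determine it; the elimination shows that every solution
  equals the computed formulas. The machine has no square root, hence the body compares the squared
  bound on the residual with \<epsilon>^2. The memory carries u_k - u_0 in place of the three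
  Halpern iterates.\<close>

lemma L2_set_sq: "(L2_set f A)\<^sup>2 = (\<Sum>i\<in>A. (f i)\<^sup>2)"
  by (simp add: L2_set_def sum_nonneg)

lemma sum_mult_le_L2_set: "(\<Sum>i\<in>A. f i * g i) \<le> L2_set f A * L2_set g A"
proof -
  have "(\<Sum>i\<in>A. f i * g i) \<le> (\<Sum>i\<in>A. \<bar>f i\<bar> * \<bar>g i\<bar>)"
    by (intro sum_mono) (metis abs_ge_self abs_mult)
  also have "\<dots> \<le> L2_set f A * L2_set g A"
    by (rule L2_set_mult_ineq)
  finally show ?thesis .
qed

text \<open>\<open>firm\<close> is firm nonexpansiveness of the map T from \<open>u k\<close> to
  \<open>ub k\<close>, in the form that (I - T) a - (I - T) b and T a - T b have nonnegative inner
  product, required only along the sequence. Vectors are coordinate functions, so finite sums and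
  \<open>L2_set\<close> apply directly.\<close>

locale halpern_iteration =
  fixes d :: nat and u ub :: "nat \<Rightarrow> nat \<Rightarrow> real"
  assumes step: "i < d \<Longrightarrow> u (Suc k) i =
      1 / real (k + 2) * u 0 i + real (k + 1) / real (k + 2) * (2 * ub k i - u k i)"
    and firm: "0 \<le> (\<Sum>i<d. ((u k i - ub k i) - (u j i - ub j i)) * (ub k i - ub j i))"
begin

abbreviation gap :: "nat \<Rightarrow> nat \<Rightarrow> real" where "gap k i \<equiv> u k i - ub k i"

text \<open>Lieder's potential; the estimate needs no fixed point.\<close>

lemma potential: "real k * (\<Sum>i<d. (gap k i)\<^sup>2) + (\<Sum>i<d. gap k i * (u k i - u 0 i)) \<le> 0"
proof (induction k)
  case (Suc k)
  \<comment> \<open>The product in \<open>firm\<close> at the indices k + 1 and k is exactly the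
    k-th potential over k + 2 minus the next potential over k + 1. Only signs matter, so the unequal
    weights do no harm in the induction.\<close>
  have coord: "(gap (Suc k) i - gap k i) * (ub (Suc k) i - ub k i) =
      (real k * (gap k i)\<^sup>2 + gap k i * (u k i - u 0 i)) / real (k + 2)
      - (real (Suc k) * (gap (Suc k) i)\<^sup>2 + gap (Suc k) i * (u (Suc k) i - u 0 i)) / real (k + 1)"
    if "i < d" for i
  proof -
    define a v v0 w b c where "a = real k" and "v = u k i" and "v0 = u 0 i" and "w = u (Suc k) i"
      and "b = gap k i" and "c = gap (Suc k) i"
    have a: "a \<ge> 0" "real (k + 2) = a + 2" "real (k + 1) = a + 1" "real (Suc k) = a + 1"
      by (auto simp: a_def)
    have w: "(a + 2) * w = v0 + (a + 1) * (v - 2 * b)"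
    proof -
      have "2 * ub k i - u k i = v - 2 * b" by (simp add: v_def b_def)
      then have "w = 1 / (a + 2) * v0 + (a + 1) / (a + 2) * (v - 2 * b)"
        using step[OF that, of k] unfolding a w_def v0_def by simp
      also have "\<dots> = (v0 + (a + 1) * (v - 2 * b)) / (a + 2)"
        by (simp only: add_divide_distrib[of v0] times_divide_eq_left mult_1)
      finally show ?thesis using a by simp
    qed
    have "(c - b) * ((w - c) - (v - b)) =
      (a * b\<^sup>2 + b * (v - v0)) / (a + 2) - ((a + 1) * c\<^sup>2 + c * (w - v0)) / (a + 1)"
    proof -
      \<comment> \<open>Solving the Halpern step for the anchor removes \<open>u 0\<close>, and both
        quotients become polynomials.\<close>
      have v0: "v0 = (a + 2) * w - (a + 1) * (v - 2 * b)" using w by simp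
      have 1: "(a * b\<^sup>2 + b * (v - v0)) / (a + 2) = b * (v - w) - b\<^sup>2"
        using a by (simp add: v0 field_simps power2_eq_square)
      have 2: "((a + 1) * c\<^sup>2 + c * (w - v0)) / (a + 1) = c\<^sup>2 + c * (v - w - 2 * b)"
        using a by (simp add: v0 field_simps power2_eq_square)
      show ?thesis unfolding 1 2 by (simp add: algebra_simps power2_eq_square)
    qed
    then show ?thesis unfolding a by (simp add: a_def w_def v_def v0_def b_def c_def)
  qed
  have "0 \<le> (\<Sum>i<d. (gap (Suc k) i - gap k i) * (ub (Suc k) i - ub k i))"
    by (rule firm)
  also have "\<dots> = (\<Sum>i<d. (real k * (gap k i)\<^sup>2 + gap k i * (u k i - u 0 i)) / real (k + 2)
      - (real (Suc k) * (gap (Suc k) i)\<^sup>2 + gap (Suc k) i * (u (Suc k) i - u 0 i)) / real (k + 1))"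
    by (intro sum.cong refl coord) simp
  also have "\<dots> = (real k * (\<Sum>i<d. (gap k i)\<^sup>2) + (\<Sum>i<d. gap k i * (u k i - u 0 i))) / real (k + 2)
      - (real (Suc k) * (\<Sum>i<d. (gap (Suc k) i)\<^sup>2)
         + (\<Sum>i<d. gap (Suc k) i * (u (Suc k) i - u 0 i))) / real (k + 1)"
    by (simp only: sum_subtractf sum.distrib sum_divide_distrib sum_distrib_left add_divide_distrib)
  finally have "(real (Suc k) * (\<Sum>i<d. (gap (Suc k) i)\<^sup>2)
         + (\<Sum>i<d. gap (Suc k) i * (u (Suc k) i - u 0 i))) / real (k + 1)
      \<le> (real k * (\<Sum>i<d. (gap k i)\<^sup>2) + (\<Sum>i<d. gap k i * (u k i - u 0 i))) / real (k + 2)"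
    by simp
  also have "\<dots> \<le> 0" using Suc.IH by (simp add: divide_nonpos_pos)
  finally show ?case by (simp add: divide_le_0_iff)
qed simp

text \<open>Writing u_k - u_0 as g_k - (u_0 - ubar_k) moves one more squared norm of g_k to the
  left, which gives the factor k + 1. Apart from g_k the right side contains only the anchor and the
  bar iterate.\<close>

lemma potential_bar: "real (k + 1) * (\<Sum>i<d. (gap k i)\<^sup>2) \<le> (\<Sum>i<d. gap k i * (u 0 i - ub k i))"
proof -
  have "(\<Sum>i<d. gap k i * (u k i - u 0 i)) = (\<Sum>i<d. (gap k i)\<^sup>2) - (\<Sum>i<d. gap k i * (u 0 i - ub k i))"
    unfolding sum_subtractf[symmetric]
    by (rule sum.cong) (auto simp: algebra_simps power2_eq_square)
  then show ?thesis using potential[of k] by (simp add: algebra_simps)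
qed

lemma norm_from_square:
  assumes "real (k + 1) * (\<Sum>i<d. (gap k i)\<^sup>2) \<le> (\<Sum>i<d. gap k i * h i)"
  shows "real (k + 1) * L2_set (gap k) {..<d} \<le> L2_set h {..<d}"
proof (cases "L2_set (gap k) {..<d} = 0")
  case True
  then show ?thesis by (simp add: L2_set_nonneg)
next
  case False
  then have pos: "L2_set (gap k) {..<d} > 0" using L2_set_nonneg[of "gap k" "{..<d}"] by linarith
  have "real (k + 1) * (L2_set (gap k) {..<d})\<^sup>2 \<le> L2_set (gap k) {..<d} * L2_set h {..<d}"
    using assms sum_mult_le_L2_set[of "gap k" h "{..<d}"] unfolding L2_set_sq by linarith
  then have "L2_set (gap k) {..<d} * (real (k + 1) * L2_set (gap k) {..<d})
      \<le> L2_set (gap k) {..<d} * L2_set h {..<d}"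
    by (simp add: power2_eq_square algebra_simps)
  then show ?thesis using pos by (simp only: mult_le_cancel_left_pos)
qed

text \<open>The preliminary rate has the numerator \<open>L2_set\<close> of u_0 - ubar_k, which
  converges and is divided by k + 1.\<close>

lemma gap_tendsto_0:
  assumes lim: "\<And>i. i < d \<Longrightarrow> (\<lambda>k. ub k i) \<longlonglongrightarrow> us i" and "i < d"
  shows "(\<lambda>k. gap k i) \<longlonglongrightarrow> 0"
proof -
  have "(\<lambda>k. L2_set (\<lambda>i. u 0 i - ub k i) {..<d} * inverse (real (Suc k)))
      \<longlonglongrightarrow> L2_set (\<lambda>i. u 0 i - us i) {..<d} * 0"
    unfolding L2_set_def
    by (intro tendsto_intros LIMSEQ_inverse_real_of_nat) (auto intro: lim)
  then have lim0: "(\<lambda>k. L2_set (\<lambda>i. u 0 i - ub k i) {..<d} * inverse (real (Suc k))) \<longlonglongrightarrow> 0"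
    by simp
  show ?thesis
  proof (rule tendsto_rabs_zero_cancel, rule tendsto_sandwich[OF _ _ tendsto_const lim0])
    show "\<forall>\<^sub>F k in sequentially.
        \<bar>gap k i\<bar> \<le> L2_set (\<lambda>i. u 0 i - ub k i) {..<d} * inverse (real (Suc k))"
    proof (rule always_eventually, rule allI)
      fix k
      have "\<bar>gap k i\<bar> \<le> L2_set (\<lambda>i. \<bar>gap k i\<bar>) {..<d}"
        by (rule member_le_L2_set) (use \<open>i < d\<close> in auto)
      also have "\<dots> = L2_set (gap k) {..<d}" by (simp add: L2_set_def)
      also have "\<dots> \<le> L2_set (\<lambda>i. u 0 i - ub k i) {..<d} * inverse (real (Suc k))"
        using norm_from_square[OF potential_bar, of k] by (simp add: field_simps)
      finally show "\<bar>gap k i\<bar> \<le> \<dots>" .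
    qed
  qed simp
qed

theorem rate:
  assumes lim: "\<And>i. i < d \<Longrightarrow> (\<lambda>k. ub k i) \<longlonglongrightarrow> us i"
  shows "real (k + 1) * L2_set (gap k) {..<d} \<le> L2_set (\<lambda>i. u 0 i - us i) {..<d}"
proof (rule norm_from_square)
  \<comment> \<open>Here j tends to infinity in \<open>firm\<close> while k stays fixed. The
    resulting nonnegative term is what replaces ubar_k by the limit in
    \<open>potential_bar\<close>.\<close>
  have "(\<lambda>j. \<Sum>i<d. (gap k i - gap j i) * (ub k i - ub j i))
      \<longlonglongrightarrow> (\<Sum>i<d. (gap k i - 0) * (ub k i - us i))"
    by (intro tendsto_sum tendsto_mult tendsto_diff tendsto_const)
      (auto intro: lim gap_tendsto_0[OF lim, simplified])
  then have "0 \<le> (\<Sum>i<d. (gap k i - 0) * (ub k i - us i))"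
    by (rule LIMSEQ_le_const) (use firm in auto)
  moreover have "(\<Sum>i<d. gap k i * (u 0 i - us i)) =
      (\<Sum>i<d. gap k i * (u 0 i - ub k i)) + (\<Sum>i<d. (gap k i - 0) * (ub k i - us i))"
    unfolding sum.distrib[symmetric] by (rule sum.cong) (auto simp: algebra_simps)
  ultimately show "real (k + 1) * (\<Sum>i<d. (gap k i)\<^sup>2) \<le> (\<Sum>i<d. gap k i * (u 0 i - us i))"
    using potential_bar[of k] by linarith
qed

end

section \<open>The constraint matrix in coordinates\<close>

lemma mixed_radix_eq_iff:
  fixes i i' m :: nat
  assumes "i < m" "i' < m"
  shows "i + m * j = i' + m * j' \<longleftrightarrow> i = i' \<and> j = j'"
proof
  assume eq: "i + m * j = i' + m * j'"
  have "(i + m * j) mod m = (i' + m * j') mod m" "(i + m * j) div m = (i' + m * j') div m"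
    by (simp_all only: eq)
  with assms show "i = i' \<and> j = j'" by simp
qed simp

lemma mixed_radix_less:
  fixes i j m n :: nat
  assumes "i < m" "j < n"
  shows "i + m * j < m * n"
proof -
  have "i + m * j < m * Suc j" using assms by simp
  also have "\<dots> \<le> m * n" using assms by (intro mult_le_mono2) simp
  finally show ?thesis .
qed

lemma div_mod_digit_iff:
  fixes r m x y :: nat
  assumes "y < m"
  shows "r div m = x \<and> r mod m = y \<longleftrightarrow> r = y + m * x"
  using assms by auto

lemma sum_lessThan_add:
  fixes f :: "nat \<Rightarrow> 'a::comm_monoid_add"
  shows "sum f {..<a + b} = sum f {..<a} + (\<Sum>i<b. f (a + i))"
  by (induction b) (simp_all add: add.assoc)

lemma sum_lessThan_mult:
  fixes f :: "nat \<Rightarrow> 'a::comm_monoid_add"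
  shows "sum f {..<a * b} = (\<Sum>j<b. \<Sum>i<a. f (i + a * j))"
proof (induction b)
  case (Suc b)
  have "sum f {..<a * Suc b} = sum f {..<a * b + a}" by (simp add: add.commute)
  also have "\<dots> = (\<Sum>j<b. \<Sum>i<a. f (i + a * j)) + (\<Sum>i<a. f (a * b + i))"
    by (simp only: sum_lessThan_add Suc.IH)
  finally show ?case by (simp add: add.commute)
qed simp

text \<open>The case of q outside the range is kept because the omitted last constraint of the third
  block falls there.\<close>

lemma sum_of_bool_eq:
  fixes f :: "nat \<Rightarrow> real"
  shows "(\<Sum>r<a. of_bool (r = q) * f r) = (if q < a then f q else 0)"
proof -
  have "(\<Sum>r<a. of_bool (r = q) * f r) = (\<Sum>r<a. if q = r then f r else 0)"
    by (rule sum.cong) auto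
  then show ?thesis by simp
qed

section \<open>Entries of Kronecker products, concatenations and block diagonal matrices\<close>

lemma dim_kron [simp]:
  "dim_row (A \<otimes>\<^sub>k B) = dim_row A * dim_row B" "dim_col (A \<otimes>\<^sub>k B) = dim_col A * dim_col B"
  by (simp_all add: kron_def)

lemma index_kron [simp]:
  "i < dim_row A * dim_row B \<Longrightarrow> j < dim_col A * dim_col B \<Longrightarrow>
    (A \<otimes>\<^sub>k B) $$ (i, j) =
      A $$ (i div dim_row B, j div dim_col B) * B $$ (i mod dim_row B, j mod dim_col B)"
  by (simp add: kron_def)

lemma dim_append_cols [simp]:
  "dim_row (A @\<^sub>c B) = dim_row A" "dim_col (A @\<^sub>c B) = dim_col A + dim_col B"
  by (simp_all add: append_cols_def)

lemma index_append_cols [simp]: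
  "i < dim_row A \<Longrightarrow> j < dim_col A + dim_col B \<Longrightarrow>
    (A @\<^sub>c B) $$ (i, j) = (if j < dim_col A then A $$ (i, j) else B $$ (i, j - dim_col A))"
  by (simp add: append_cols_def)

lemma dim_append_rows [simp]:
  "dim_row (A @\<^sub>r B) = dim_row A + dim_row B" "dim_col (A @\<^sub>r B) = dim_col A"
  by (simp_all add: append_rows_def)

lemma index_append_rows:
  "i < dim_row A + dim_row B \<Longrightarrow> j < dim_col A \<Longrightarrow>
    (A @\<^sub>r B) $$ (i, j) = (if i < dim_row A then A $$ (i, j) else B $$ (i - dim_row A, j))"
  by (simp add: append_rows_def)

lemma dim_ones_row [simp]: "dim_row (ones_row p) = 1" "dim_col (ones_row p) = p"
  by (simp_all add: ones_row_def)

lemma index_ones_row [simp]: "j < p \<Longrightarrow> ones_row p $$ (0, j) = 1"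
  by (simp add: ones_row_def)

lemma dim_Ibar [simp]: "dim_row (Ibar p) = p - 1" "0 < p \<Longrightarrow> dim_col (Ibar p) = p"
  by (simp_all add: Ibar_def)

lemma index_Ibar [simp]:
  "i < p - 1 \<Longrightarrow> j < p \<Longrightarrow> Ibar p $$ (i, j) = of_bool (i = j)"
  by (auto simp: Ibar_def)

text \<open>All blocks have s columns and only the last may have fewer rows, so r div p and c div s
  still name the block. This is the shape of \<open>matA4\<close>, whose last block lacks one
  row.\<close>

lemma index_diag_block_replicate:
  fixes B D :: "real mat"
  assumes B: "B \<in> carrier_mat p s" and D: "D \<in> carrier_mat p' s" and p': "p' \<le> p" "0 < s"
    and "r < q * p + p'" "c < (q + 1) * s"
  shows "diag_block_mat (replicate q B @ [D]) $$ (r, c) =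
    (if r div p = c div s then if r div p < q then B $$ (r mod p, c mod s) else D $$ (r mod p, c mod s)
     else 0)"
  using assms(5,6)
proof (induction q arbitrary: r c)
  case 0
  then have "r < p" using p' by simp
  with 0 D show ?case by (simp del: diag_block_mat.simps)
next
  case (Suc q)
  let ?E = "diag_block_mat (replicate q B @ [D])"
  have p: "0 < p"
  proof (rule ccontr)
    assume "\<not> 0 < p"
    with Suc.prems p' show False by simp
  qed
  have dim: "dim_row ?E = q * p + p'" "dim_col ?E = (q + 1) * s"
    using B D by (auto simp: dim_diag_block_mat sum_list_replicate)
  have "diag_block_mat (replicate (Suc q) B @ [D]) $$ (r, c) =
      (if r < p then if c < s then B $$ (r, c) else 0
       else if c < s then 0 else ?E $$ (r - p, c - s))"
    using B D Suc.prems dim p' by (auto simp: Let_def)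
  also have "\<dots> = (if r div p = c div s then
      if r div p < Suc q then B $$ (r mod p, c mod s) else D $$ (r mod p, c mod s) else 0)"
  proof (cases "r < p"; cases "c < s")
    assume rc: "\<not> r < p" "\<not> c < s"
    have "?E $$ (r - p, c - s) = (if (r - p) div p = (c - s) div s then
       if (r - p) div p < q then B $$ ((r - p) mod p, (c - s) mod s)
       else D $$ ((r - p) mod p, (c - s) mod s) else 0)"
      by (rule Suc.IH) (use rc Suc.prems in auto)
    moreover have "r div p = Suc ((r - p) div p)" "c div s = Suc ((c - s) div s)"
      "(r - p) mod p = r mod p" "(c - s) mod s = c mod s"
      using rc p p' by (auto simp: le_div_geq le_mod_geq)
    ultimately show ?thesis using rc by simp
  next
    assume rc: "r < p" "\<not> c < s"
    then have "c div s \<noteq> 0" using p' by (auto simp: div_eq_0_iff)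
    then show ?thesis using rc by simp
  next
    assume rc: "\<not> r < p" "c < s"
    then have "r div p \<noteq> 0" using p by (auto simp: div_eq_0_iff)
    then show ?thesis using rc by simp
  qed simp
  finally show ?case .
qed

section \<open>Entries of the constraint matrix\<close>

context
  fixes m n :: nat
  assumes m: "0 < m" and n: "0 < n"
begin

lemma dimM_pos: "0 < dimM m n"
  using m n by (simp add: dimM_def)

lemma dim_matA1: "dim_row (matA1 m n) = dimM m n" "dim_col (matA1 m n) = m^2 * n"
  by (simp_all add: matA1_def dimM_def power2_eq_square)

lemma dim_matA2: "dim_row (matA2 m n) = dimM m n" "dim_col (matA2 m n) = m * n^2"
  by (simp_all add: matA2_def dimM_def power2_eq_square)

lemma dim_matA3: "dim_row (matA3 m n) = dimM m n" "dim_col (matA3 m n) = m^2 * n"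
  by (simp_all add: matA3_def dimM_def power2_eq_square)

lemma dim_matA4: "dim_row (matA4 m n) = dimM m n - 1" "dim_col (matA4 m n) = m * n^2"
proof -
  obtain n' where n': "n = Suc n'" using n gr0_implies_Suc by blast
  show "dim_row (matA4 m n) = dimM m n - 1" "dim_col (matA4 m n) = m * n^2"
    using m by (auto simp: matA4_def dim_diag_block_mat sum_list_replicate dimM_def n'
      power2_eq_square algebra_simps)
qed

lemma dim_matA: "dim_row (matA m n) = dimM3 m n" "dim_col (matA m n) = dimN m n"
  using dimM_pos by (auto simp: matA_def dim_matA1 dim_matA2 dim_matA3 dim_matA4 dimM3_def dimN_def)

lemma matA_carrier: "matA m n \<in> carrier_mat (dimM3 m n) (dimN m n)"
  using dim_matA by auto

lemma index_matA1:
  assumes "r < dimM m n" "c < m^2 * n"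
  shows "matA1 m n $$ (r, c) = of_bool (r = c div m)"
proof -
  have c: "c < dimM m n * m" using assms by (simp add: dimM_def power2_eq_square algebra_simps)
  then have "c div m < dimM m n" by (simp add: less_mult_imp_div_less)
  with assms c m show ?thesis by (simp add: matA1_def)
qed

lemma index_matA2:
  assumes "r < dimM m n" "c < m * n^2"
  shows "matA2 m n $$ (r, c) = - of_bool (r = c mod dimM m n)"
proof -
  have c: "c < n * dimM m n" using assms by (simp add: dimM_def power2_eq_square algebra_simps)
  then have "c div dimM m n < n" by (simp add: less_mult_imp_div_less)
  with assms c dimM_pos show ?thesis by (simp add: matA2_def)
qed

lemma index_matA3:
  assumes "r < dimM m n" "c < m^2 * n"
  shows "matA3 m n $$ (r, c) = of_bool (r = c mod m + m * (c div (m * m)))"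
proof -
  have c: "c < n * (m * m)" using assms by (simp add: power2_eq_square algebra_simps)
  then have 1: "c div (m * m) < n" by (simp add: less_mult_imp_div_less)
  have r: "r < n * m" using assms by (simp add: dimM_def algebra_simps)
  then have 2: "r div m < n" by (simp add: less_mult_imp_div_less)
  have 3: "c mod (m * m) < m * m" using m by simp
  then have 4: "c mod (m * m) div m < m" by (simp add: less_mult_imp_div_less)
  have "matA3 m n $$ (r, c) = of_bool (r div m = c div (m * m) \<and> r mod m = c mod m)"
    using r c 1 2 3 4 m by (simp add: matA3_def mod_mult_eq mod_mult2_eq)
  then show ?thesis
    using div_mod_digit_iff[of "c mod m" m r "c div (m * m)"] m by simp
qed

lemma index_matA4:
  assumes "r < dimM m n - 1" "c < m * n^2"
  shows "matA4 m n $$ (r, c) = of_bool (r = c mod m + m * (c div dimM m n))"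
proof -
  obtain n' where n': "n = Suc n'" using n gr0_implies_Suc by blast
  have r: "r < n' * m + (m - 1)" using assms m by (simp add: dimM_def n' algebra_simps)
  have c: "c < (n' + 1) * (n * m)" using assms by (simp add: n' power2_eq_square algebra_simps)
  have c1: "c mod (n * m) < n * m" using m n by simp
  then have c2: "c mod (n * m) div m < n" by (simp add: less_mult_imp_div_less)
  have c3: "c mod (n * m) mod m = c mod m" by (simp add: mod_mod_cancel)
  have c4: "c div dimM m n = c div (n * m)" by (simp add: dimM_def mult.commute)
  \<comment> \<open>In the last block the row bound keeps the remainder below m - 1, where
    \<open>Ibar m\<close> has the entries of the identity.\<close>
  have last: "r mod m < m - 1" if "\<not> r div m < n'"
  proof -
    have "n' \<le> r div m" using that by simp
    then have "n' * m \<le> r" using m by (simp add: less_eq_div_iff_mult_less_eq)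
    then obtain e where e: "r = e + n' * m" using le_Suc_ex add.commute by metis
    then have "e < m - 1" using r by simp
    then show ?thesis using e by simp
  qed
  have "matA4 m n $$ (r, c) = (if r div m = c div (n * m) then
      if r div m < n' then (ones_row n \<otimes>\<^sub>k 1\<^sub>m m) $$ (r mod m, c mod (n * m))
      else (ones_row n \<otimes>\<^sub>k Ibar m) $$ (r mod m, c mod (n * m)) else 0)"
  proof -
    have "matA4 m n = diag_block_mat (replicate n' (ones_row n \<otimes>\<^sub>k 1\<^sub>m m) @ [ones_row n \<otimes>\<^sub>k Ibar m])"
      by (simp add: matA4_def n')
    moreover have "ones_row n \<otimes>\<^sub>k 1\<^sub>m m \<in> carrier_mat m (n * m)"
      by (rule carrier_matI) simp_all
    moreover have "ones_row n \<otimes>\<^sub>k Ibar m \<in> carrier_mat (m - 1) (n * m)"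
      using m by (intro carrier_matI) simp_all
    moreover have "m - 1 \<le> m" "0 < n * m" using m n by simp_all
    ultimately show ?thesis
      using r c by (simp only: index_diag_block_replicate)
  qed
  also have "\<dots> = of_bool (r div m = c div (n * m) \<and> r mod m = c mod m)"
    using c1 c2 c3 m last by auto
  finally show ?thesis
    using div_mod_digit_iff[of "c mod m" m r "c div (n * m)"] m c4 by simp
qed

lemma index_matA:
  assumes "r < dimM3 m n" "c < dimN m n"
  shows "matA m n $$ (r, c) =
    (if r < dimM m n then
       if c < m^2 * n then of_bool (r = c div m)
       else - of_bool (r = (c - m^2 * n) mod dimM m n)
     else if r < 2 * dimM m n then
       if c < m^2 * n then of_bool (r - dimM m n = c mod m + m * (c div (m * m))) else 0
     else if c < m^2 * n then 0
       else of_bool (r - 2 * dimM m n = (c - m^2 * n) mod m + m * ((c - m^2 * n) div dimM m n)))"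
proof -
  have c: "c < m^2 * n + m * n^2" using assms by (simp add: dimN_def)
  have r: "r < dimM m n + (dimM m n + (dimM m n - 1))"
    using assms dimM_pos by (simp add: dimM3_def)
  show ?thesis
    using c r
    by (auto simp: matA_def index_append_rows dim_matA1 dim_matA2 dim_matA3 dim_matA4
        index_matA1 index_matA2 index_matA3 index_matA4 algebra_simps simp flip: mult_2)
qed

text \<open>Positions of the two legs of a transport path: \<open>flow1 i k j\<close> carries mass
  from cell (i, j) to the intermediate cell (k, j), and \<open>flow2 k j l\<close> carries it on to
  cell (k, l). The digit orders are those of the cost vector.\<close>

abbreviation flow1 :: "nat \<Rightarrow> nat \<Rightarrow> nat \<Rightarrow> nat" where
  "flow1 i k j \<equiv> i + m * (k + m * j)"

abbreviation flow2 :: "nat \<Rightarrow> nat \<Rightarrow> nat \<Rightarrow> nat" where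
  "flow2 k j l \<equiv> m^2 * n + (k + m * (j + n * l))"

lemma flow1_less:
  assumes "i < m" "k < m" "j < n"
  shows "flow1 i k j < m^2 * n"
  using mixed_radix_less[OF assms(1) mixed_radix_less[OF assms(2,3)]]
  by (simp add: power2_eq_square mult.assoc)

lemma flow2_less:
  assumes "k < m" "j < n" "l < n"
  shows "flow2 k j l < dimN m n"
  using mixed_radix_less[OF assms(1) mixed_radix_less[OF assms(2,3)]]
  by (simp add: power2_eq_square mult.assoc dimN_def)

lemma flow2_digits:
  assumes "k < m" "j < n" "l < n"
  shows "(k + m * (j + n * l)) mod m = k" "(k + m * (j + n * l)) mod dimM m n = k + m * j"
    "(k + m * (j + n * l)) div dimM m n = l"
  using assms by (simp_all add: dimM_def mod_mult2_eq div_mult2_eq)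

lemma flow1_digits:
  assumes "i < m" "k < m" "j < n"
  shows "(i + m * (k + m * j)) mod m = i" "(i + m * (k + m * j)) div m = k + m * j"
    "(i + m * (k + m * j)) div (m * m) = j"
  using assms by (simp_all add: div_mult2_eq)

lemma sum_dimN:
  fixes f :: "nat \<Rightarrow> real"
  shows "(\<Sum>c<dimN m n. f c) =
    (\<Sum>j<n. \<Sum>k<m. \<Sum>i<m. f (flow1 i k j)) + (\<Sum>l<n. \<Sum>j<n. \<Sum>k<m. f (flow2 k j l))"
proof -
  have "(\<Sum>c<dimN m n. f c) = (\<Sum>c<m * (m * n). f c) + (\<Sum>c<m * (n * n). f (m^2 * n + c))"
    unfolding dimN_def sum_lessThan_add by (simp add: power2_eq_square mult.assoc)
  then show ?thesis unfolding sum_lessThan_mult .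
qed

lemma sum_dimM3:
  fixes f :: "nat \<Rightarrow> real"
  shows "(\<Sum>r<dimM3 m n. f r) = (\<Sum>r<dimM m n. f r) + (\<Sum>r<dimM m n. f (dimM m n + r))
    + (\<Sum>r<dimM m n - 1. f (2 * dimM m n + r))"
proof -
  have "dimM3 m n = (dimM m n + dimM m n) + (dimM m n - 1)"
    using dimM_pos by (simp add: dimM3_def)
  then show ?thesis by (simp only: sum_lessThan_add) (simp add: mult_2)
qed

section \<open>Products with the constraint matrix and its transpose\<close>

lemma matA_mult_index:
  assumes "x \<in> carrier_vec (dimN m n)" "r < dimM3 m n"
  shows "(matA m n *\<^sub>v x) $ r = (\<Sum>c<dimN m n. matA m n $$ (r, c) * x $ c)"
  using assms dim_matA by (auto simp: scalar_prod_def atLeast0LessThan)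

lemma matA_transpose_mult_index:
  assumes "y \<in> carrier_vec (dimM3 m n)" "c < dimN m n"
  shows "(transpose_mat (matA m n) *\<^sub>v y) $ c = (\<Sum>r<dimM3 m n. matA m n $$ (r, c) * y $ r)"
  using assms dim_matA by (auto simp: scalar_prod_def atLeast0LessThan)

lemma transpose_matA_flow1:
  assumes y: "y \<in> carrier_vec (dimM3 m n)" and ikj: "i < m" "k < m" "j < n"
  shows "(transpose_mat (matA m n) *\<^sub>v y) $ flow1 i k j = y $ (k + m * j) + y $ (dimM m n + (i + m * j))"
proof -
  have c: "flow1 i k j < dimN m n" "flow1 i k j < m^2 * n"
    using flow1_less[OF ikj] by (simp_all add: dimN_def)
  have q: "k + m * j < dimM m n" "i + m * j < dimM m n"
    using ikj by (simp_all add: dimM_def mixed_radix_less)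
  have "(\<Sum>r<dimM m n. matA m n $$ (r, flow1 i k j) * y $ r)
      = (\<Sum>r<dimM m n. of_bool (r = k + m * j) * y $ r)"
    using c dimM_pos ikj by (intro sum.cong refl) (simp add: index_matA dimM3_def flow1_digits[OF ikj])
  moreover have "(\<Sum>r<dimM m n. matA m n $$ (dimM m n + r, flow1 i k j) * y $ (dimM m n + r))
      = (\<Sum>r<dimM m n. of_bool (r = i + m * j) * y $ (dimM m n + r))"
    using c dimM_pos ikj by (intro sum.cong refl) (simp add: index_matA dimM3_def flow1_digits[OF ikj])
  moreover have "(\<Sum>r<dimM m n - 1. matA m n $$ (2 * dimM m n + r, flow1 i k j) * y $ (2 * dimM m n + r)) = 0"
    using c dimM_pos by (intro sum.neutral) (simp add: index_matA dimM3_def)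
  ultimately show ?thesis
    using q by (simp add: matA_transpose_mult_index[OF y c(1)] sum_dimM3 sum_of_bool_eq)
qed

text \<open>The constraint of the last target cell is absent from A, so its multiplier reads as
  0.\<close>

lemma transpose_matA_flow2:
  assumes y: "y \<in> carrier_vec (dimM3 m n)" and kjl: "k < m" "j < n" "l < n"
  shows "(transpose_mat (matA m n) *\<^sub>v y) $ flow2 k j l = - y $ (k + m * j)
    + (if k + m * l < dimM m n - 1 then y $ (2 * dimM m n + (k + m * l)) else 0)"
proof -
  note c = flow2_less[OF kjl]
  have q: "k + m * j < dimM m n"
    using kjl by (simp_all add: dimM_def mixed_radix_less)
  have "(\<Sum>r<dimM m n. matA m n $$ (r, flow2 k j l) * y $ r)
      = (\<Sum>r<dimM m n. of_bool (r = k + m * j) * - y $ r)"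
    using c dimM_pos kjl by (intro sum.cong refl) (simp add: index_matA dimM3_def flow2_digits[OF kjl])
  moreover have "(\<Sum>r<dimM m n. matA m n $$ (dimM m n + r, flow2 k j l) * y $ (dimM m n + r)) = 0"
    using c dimM_pos by (intro sum.neutral) (simp add: index_matA dimM3_def)
  moreover have "(\<Sum>r<dimM m n - 1. matA m n $$ (2 * dimM m n + r, flow2 k j l) * y $ (2 * dimM m n + r))
      = (\<Sum>r<dimM m n - 1. of_bool (r = k + m * l) * y $ (2 * dimM m n + r))"
    using c dimM_pos kjl by (intro sum.cong refl) (simp add: index_matA dimM3_def flow2_digits[OF kjl])
  ultimately show ?thesis
    using q by (simp add: matA_transpose_mult_index[OF y c] sum_dimM3 sum_of_bool_eq sum_negf)
qed

lemma sum_of_bool_pair: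
  fixes f :: "nat \<Rightarrow> nat \<Rightarrow> real"
  assumes "k' < a" "j' < b"
  shows "(\<Sum>j<b. \<Sum>k<a. of_bool (k = k' \<and> j = j') * f k j) = f k' j'"
proof -
  have "(\<Sum>j<b. \<Sum>k<a. of_bool (k = k' \<and> j = j') * f k j)
      = (\<Sum>j<b. of_bool (j = j') * (\<Sum>k<a. of_bool (k = k') * f k j))"
    unfolding sum_distrib_left by (intro sum.cong) auto
  then show ?thesis using assms by (simp add: sum_of_bool_eq)
qed

text \<open>Flow conservation at the intermediate cell (k, j). The other two row groups are the mass
  leaving a source cell and the mass reaching a target cell.\<close>

lemma matA_row1:
  assumes x: "x \<in> carrier_vec (dimN m n)" and kj: "k < m" "j < n"
  shows "(matA m n *\<^sub>v x) $ (k + m * j) = (\<Sum>i<m. x $ flow1 i k j) - (\<Sum>l<n. x $ flow2 k j l)"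
proof -
  have q: "k + m * j < dimM m n" using kj by (simp add: dimM_def mixed_radix_less)
  then have r: "k + m * j < dimM3 m n" by (simp add: dimM3_def)
  have "(\<Sum>j'<n. \<Sum>k'<m. \<Sum>i<m. matA m n $$ (k + m * j, flow1 i k' j') * x $ flow1 i k' j')
      = (\<Sum>j'<n. \<Sum>k'<m. of_bool (k' = k \<and> j' = j) * (\<Sum>i<m. x $ flow1 i k' j'))"
    unfolding sum_distrib_left
  proof (intro sum.cong refl)
    fix j' k' i assume *: "j' \<in> {..<n}" "k' \<in> {..<m}" "i \<in> {..<m}"
    then have "flow1 i k' j' < m^2 * n" by (simp add: flow1_less)
    with * q r kj show "matA m n $$ (k + m * j, flow1 i k' j') * x $ flow1 i k' j'
        = of_bool (k' = k \<and> j' = j) * x $ flow1 i k' j'"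
      by (auto simp: index_matA dimN_def flow1_digits mixed_radix_eq_iff)
  qed
  moreover have "(\<Sum>l<n. \<Sum>j'<n. \<Sum>k'<m. matA m n $$ (k + m * j, flow2 k' j' l) * x $ flow2 k' j' l)
      = (\<Sum>l<n. \<Sum>j'<n. \<Sum>k'<m. of_bool (k' = k \<and> j' = j) * - x $ flow2 k' j' l)"
  proof (intro sum.cong refl)
    fix j' k' l assume *: "j' \<in> {..<n}" "k' \<in> {..<m}" "l \<in> {..<n}"
    then have "flow2 k' j' l < dimN m n" by (simp add: flow2_less)
    with * q r kj show "matA m n $$ (k + m * j, flow2 k' j' l) * x $ flow2 k' j' l
        = of_bool (k' = k \<and> j' = j) * - x $ flow2 k' j' l"
      by (auto simp: index_matA flow2_digits mixed_radix_eq_iff)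
  qed
  ultimately show ?thesis
    using kj by (simp only: matA_mult_index[OF x r] sum_dimN sum_of_bool_pair sum_negf)
qed

lemma matA_row2:
  assumes x: "x \<in> carrier_vec (dimN m n)" and ij: "i < m" "j < n"
  shows "(matA m n *\<^sub>v x) $ (dimM m n + (i + m * j)) = (\<Sum>k<m. x $ flow1 i k j)"
proof -
  have q: "i + m * j < dimM m n" using ij by (simp add: dimM_def mixed_radix_less)
  then have r: "dimM m n + (i + m * j) < dimM3 m n" by (simp add: dimM3_def)
  have "(\<Sum>j'<n. \<Sum>k<m. \<Sum>i'<m.
        matA m n $$ (dimM m n + (i + m * j), flow1 i' k j') * x $ flow1 i' k j')
      = (\<Sum>j'<n. \<Sum>k<m. \<Sum>i'<m. of_bool (i' = i \<and> j' = j) * x $ flow1 i' k j')"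
  proof (intro sum.cong refl)
    fix j' k i' assume *: "j' \<in> {..<n}" "k \<in> {..<m}" "i' \<in> {..<m}"
    then have "flow1 i' k j' < m^2 * n" by (simp add: flow1_less)
    with * q r ij show "matA m n $$ (dimM m n + (i + m * j), flow1 i' k j') * x $ flow1 i' k j'
        = of_bool (i' = i \<and> j' = j) * x $ flow1 i' k j'"
      by (auto simp: index_matA dimN_def flow1_digits mixed_radix_eq_iff)
  qed
  \<comment> \<open>\<open>sum_of_bool_pair\<close> collapses the two innermost sums, so the free
    index k is moved outermost.\<close>
  moreover have "\<dots> = (\<Sum>k<m. \<Sum>j'<n. \<Sum>i'<m. of_bool (i' = i \<and> j' = j) * x $ flow1 i' k j')"
    by (rule sum.swap)
  moreover have "(\<Sum>l<n. \<Sum>j'<n. \<Sum>k<m.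
        matA m n $$ (dimM m n + (i + m * j), flow2 k j' l) * x $ flow2 k j' l) = 0"
    using q r flow2_less by (intro sum.neutral ballI) (simp add: index_matA)
  ultimately show ?thesis
    using ij by (simp only: matA_mult_index[OF x r] sum_dimN sum_of_bool_pair add_0_left add_0_right)
qed

lemma matA_row3:
  assumes x: "x \<in> carrier_vec (dimN m n)" and kl: "k < m" "l < n" "k + m * l < dimM m n - 1"
  shows "(matA m n *\<^sub>v x) $ (2 * dimM m n + (k + m * l)) = (\<Sum>j<n. x $ flow2 k j l)"
proof -
  have r: "2 * dimM m n + (k + m * l) < dimM3 m n" using kl by (simp add: dimM3_def)
  have "(\<Sum>l'<n. \<Sum>j<n. \<Sum>k'<m.
        matA m n $$ (2 * dimM m n + (k + m * l), flow2 k' j l') * x $ flow2 k' j l')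
      = (\<Sum>l'<n. \<Sum>j<n. \<Sum>k'<m. of_bool (k' = k \<and> l' = l) * x $ flow2 k' j l')"
  proof (intro sum.cong refl)
    fix j k' l' assume *: "j \<in> {..<n}" "k' \<in> {..<m}" "l' \<in> {..<n}"
    then have "flow2 k' j l' < dimN m n" by (simp add: flow2_less)
    with * r kl show "matA m n $$ (2 * dimM m n + (k + m * l), flow2 k' j l') * x $ flow2 k' j l'
        = of_bool (k' = k \<and> l' = l) * x $ flow2 k' j l'"
      by (auto simp: index_matA flow2_digits mixed_radix_eq_iff)
  qed
  moreover have "\<dots> = (\<Sum>j<n. \<Sum>l'<n. \<Sum>k'<m. of_bool (k' = k \<and> l' = l) * x $ flow2 k' j l')"
    by (rule sum.swap)
  moreover have "(\<Sum>j<n. \<Sum>k'<m. \<Sum>i<m.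
        matA m n $$ (2 * dimM m n + (k + m * l), flow1 i k' j) * x $ flow1 i k' j) = 0"
  proof (intro sum.neutral ballI)
    fix j k' i assume "j \<in> {..<n}" "k' \<in> {..<m}" "i \<in> {..<m}"
    then have "flow1 i k' j < m^2 * n" by (simp add: flow1_less)
    with r show "matA m n $$ (2 * dimM m n + (k + m * l), flow1 i k' j) * x $ flow1 i k' j = 0"
      by (simp add: index_matA dimN_def)
  qed
  ultimately show ?thesis
    using kl by (simp only: matA_mult_index[OF x r] sum_dimN sum_of_bool_pair add_0_left add_0_right)
qed

end

section \<open>The residual bound\<close>

lemma scalar_prod_sum:
  assumes "w \<in> carrier_vec d"
  shows "v \<bullet> w = (\<Sum>i<d. v $ i * w $ i)"
  using assms by (simp add: scalar_prod_def atLeast0LessThan)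

lemma vnorm_sq:
  assumes "v \<in> carrier_vec d"
  shows "(vnorm v)\<^sup>2 = (\<Sum>i<d. (v $ i)\<^sup>2)"
  using assms by (simp add: vnorm_def scalar_prod_sum power2_eq_square sum_nonneg)

lemma vnorm_eq_L2_set:
  assumes "v \<in> carrier_vec d"
  shows "vnorm v = L2_set (\<lambda>i. v $ i) {..<d}"
  using assms by (simp add: vnorm_def scalar_prod_sum power2_eq_square L2_set_def)

lemma vnorm_nonneg: "0 \<le> vnorm v"
  using vnorm_eq_L2_set[OF carrier_vec_dim_vec, of v] by (simp add: L2_set_nonneg)

lemma vnorm_append_sq: "(vnorm (v @\<^sub>v w))\<^sup>2 = (vnorm v)\<^sup>2 + (vnorm w)\<^sup>2"
proof -
  have "v @\<^sub>v w \<in> carrier_vec (dim_vec v + dim_vec w)"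
    by (intro append_carrier_vec carrier_vec_dim_vec)
  then have "(vnorm (v @\<^sub>v w))\<^sup>2 = (\<Sum>i<dim_vec v + dim_vec w. ((v @\<^sub>v w) $ i)\<^sup>2)"
    by (rule vnorm_sq)
  also have "\<dots> = (\<Sum>i<dim_vec v. (v $ i)\<^sup>2) + (\<Sum>i<dim_vec w. (w $ i)\<^sup>2)"
    by (simp add: sum_lessThan_add)
  finally show ?thesis
    by (simp only: vnorm_sq[OF carrier_vec_dim_vec])
qed

lemma vtendsto_index:
  assumes "vtendsto d v l" "i < d"
  shows "(\<lambda>k. v k $ i) \<longlonglongrightarrow> l $ i"
proof -
  have vl: "v k \<in> carrier_vec d" "l \<in> carrier_vec d" for k
    using assms(1) by (auto simp: vtendsto_def)
  have lim: "(\<lambda>k. vnorm (v k - l)) \<longlonglongrightarrow> 0"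
    using assms(1) by (simp add: vtendsto_def)
  have "\<bar>v k $ i - l $ i\<bar> \<le> vnorm (v k - l)" for k
  proof -
    have "\<bar>(v k - l) $ i\<bar> \<le> L2_set (\<lambda>i. \<bar>(v k - l) $ i\<bar>) {..<d}"
      by (rule member_le_L2_set) (use assms(2) in auto)
    also have "\<dots> = vnorm (v k - l)"
      using vl by (simp add: vnorm_eq_L2_set[of _ d] L2_set_def)
    finally show ?thesis using vl assms(2) by simp
  qed
  then have "(\<lambda>k. v k $ i - l $ i) \<longlonglongrightarrow> 0"
    by (intro tendsto_rabs_zero_cancel[OF tendsto_sandwich[OF _ _ tendsto_const lim]]) auto
  then show ?thesis by (rule LIM_zero_cancel)
qed

definition pos_part :: "real vec \<Rightarrow> real vec" where
  "pos_part v = map_vec (max 0) v"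

lemma pos_part_index: "i < dim_vec v \<Longrightarrow> pos_part v $ i = max 0 (v $ i)"
  by (simp add: pos_part_def)

lemma pos_part_orthant: "v \<in> carrier_vec d \<Longrightarrow> pos_part v \<in> orthant d"
  by (auto simp: pos_part_def orthant_def)

text \<open>The squared distance separates over the coordinates and \<open>pos_part\<close> is best
  in each one. Uniqueness matters as much as minimality: \<open>eucl_proj\<close> is defined by
  choice, and \<open>zbar\<close> is known only as some minimiser.\<close>

lemma is_arg_min_orthant_iff:
  assumes v: "v \<in> carrier_vec d"
  shows "is_arg_min (\<lambda>u. vnorm (u - v)) (\<lambda>u. u \<in> orthant d) u \<longleftrightarrow> u = pos_part v"
proof -
  have p: "pos_part v \<in> orthant d" using v by (rule pos_part_orthant)
  have sq: "(vnorm (w - v))\<^sup>2 = (\<Sum>i<d. (w $ i - v $ i)\<^sup>2)" if "w \<in> orthant d" for w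
    using that v by (simp add: vnorm_sq[of _ d] orthant_def)
  have pt: "(pos_part v $ i - v $ i)\<^sup>2 \<le> (w $ i - v $ i)\<^sup>2" if "w \<in> orthant d" "i < d" for w i
    using that v
    by (auto simp: pos_part_index orthant_def max_def abs_le_square_iff[symmetric])
  have le: "vnorm (pos_part v - v) \<le> vnorm (w - v)" if "w \<in> orthant d" for w
    by (rule power2_le_imp_le) (use that p pt in \<open>auto simp: sq vnorm_nonneg intro!: sum_mono\<close>)
  show ?thesis
  proof
    assume u: "is_arg_min (\<lambda>u. vnorm (u - v)) (\<lambda>u. u \<in> orthant d) u"
    then have uo: "u \<in> orthant d" by (simp add: is_arg_min_def)
    have "vnorm (u - v) \<le> vnorm (pos_part v - v)"
      using u p by (auto simp: is_arg_min_def not_less)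
    then have "(vnorm (u - v))\<^sup>2 \<le> (vnorm (pos_part v - v))\<^sup>2"
      by (rule power_mono) (rule vnorm_nonneg)
    then have "(\<Sum>i<d. (u $ i - v $ i)\<^sup>2 - (pos_part v $ i - v $ i)\<^sup>2) \<le> 0"
      by (simp add: sq uo p sum_subtractf)
    moreover have nn: "0 \<le> (u $ i - v $ i)\<^sup>2 - (pos_part v $ i - v $ i)\<^sup>2" if "i < d" for i
      using pt[OF uo that] by simp
    ultimately have "(\<Sum>i<d. (u $ i - v $ i)\<^sup>2 - (pos_part v $ i - v $ i)\<^sup>2) = 0"
      by (intro antisym sum_nonneg) auto
    then have eq: "(u $ i - v $ i)\<^sup>2 = (pos_part v $ i - v $ i)\<^sup>2" if "i < d" for i
      using that nn by (subst (asm) sum_nonneg_eq_0_iff) auto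
    \<comment> \<open>Equal squared distances leave, for negative v_i, only 0 or 2 v_i, and the sign
      of u_i excludes the latter.\<close>
    have "u $ i = pos_part v $ i" if "i < d" for i
    proof -
      have "0 \<le> u $ i" using uo that by (simp add: orthant_def)
      then show ?thesis
        using eq[OF that] that v
        by (auto simp: pos_part_index max_def power2_eq_iff split: if_splits)
    qed
    then show "u = pos_part v"
      using uo p by (intro eq_vecI) (auto simp: orthant_def)
  next
    assume "u = pos_part v"
    with p le show "is_arg_min (\<lambda>u. vnorm (u - v)) (\<lambda>u. u \<in> orthant d) u"
      by (auto simp: is_arg_min_def not_less)
  qed
qed

lemma eucl_proj_orthant: "v \<in> carrier_vec d \<Longrightarrow> eucl_proj (orthant d) v = pos_part v"
  by (simp add: eucl_proj_def arg_min_def is_arg_min_orthant_iff)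

text \<open>First-order optimality of a quadratic without derivatives. The test point -a / (1 + q)
  needs no case distinction at q = 0 and gives the value -(a / (1 + q))^2.\<close>

lemma linear_coeff_eq_0:
  fixes a q :: real
  assumes nonneg: "\<And>t. 0 \<le> t * a + t\<^sup>2 * q" and "0 \<le> q"
  shows "a = 0"
proof -
  have "0 \<le> (- a / (1 + q)) * a + (- a / (1 + q))\<^sup>2 * q" by (rule nonneg)
  also have "\<dots> = - (a\<^sup>2 / (1 + q)\<^sup>2)"
    using \<open>0 \<le> q\<close> by (simp add: divide_simps power2_eq_square) (simp add: algebra_simps)
  finally have "a\<^sup>2 / (1 + q)\<^sup>2 \<le> 0" by simp
  moreover have "0 < (1 + q)\<^sup>2" using \<open>0 \<le> q\<close> by simp
  ultimately show ?thesis by (simp add: divide_le_0_iff)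
qed

text \<open>Firm nonexpansiveness of the projection in one coordinate. If a and b have the same sign
  both sides agree; the auxiliary inequality treats mixed signs.\<close>

lemma max_0_firm:
  fixes a b :: real
  shows "(max 0 a - max 0 b) * (max 0 a - max 0 b) \<le> (max 0 a - max 0 b) * (a - b)"
proof -
  have "a * a \<le> a * (a - b)" if "0 \<le> a" "b \<le> 0" for a b :: real
    using that by (intro mult_left_mono) auto
  from this[of a b] this[of b a] show ?thesis
    by (auto simp: max_def algebra_simps)
qed

lemma vecc_carrier: "vecc m n \<in> carrier_vec (dimN m n)"
  unfolding vecc_def dimN_def by (intro append_carrier_vec vec_carrier)

section \<open>A fixed run of the algorithm as a Halpern iteration\<close>

locale hot =
  fixes m n :: nat and \<mu>1 \<mu>2 :: "real vec" and \<sigma> :: real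
    and y z x ybar zbar xbar :: "nat \<Rightarrow> real vec" and xstar zstar :: "real vec"
  assumes m: "0 < m" and n: "0 < n"
    and run: "hot_run m n \<mu>1 \<mu>2 \<sigma> y z x ybar zbar xbar xstar zstar"
begin

abbreviation "A \<equiv> matA m n"
abbreviation "b \<equiv> vecb m n \<mu>1 \<mu>2"
abbreviation "c \<equiv> vecc m n"
abbreviation "N \<equiv> dimN m n"
abbreviation "M3 \<equiv> dimM3 m n"

lemma sigma: "0 < \<sigma>"
  using run by (simp add: hot_run_def)

lemma mu_carrier: "\<mu>1 \<in> carrier_vec (dimM m n)" "\<mu>2 \<in> carrier_vec (dimM m n)"
  using run unfolding hot_run_def histogram_def orthant_def by blast+

lemmas A_carrier = matA_carrier[OF m n]

lemma b_carrier: "b \<in> carrier_vec M3"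
proof -
  have "dimM m n + (dimM m n + (dimM m n - 1)) = M3"
    using dimM_pos[OF m n] by (simp add: dimM3_def)
  moreover have "Ibar (dimM m n) *\<^sub>v \<mu>2 \<in> carrier_vec (dimM m n - 1)"
    by (rule carrier_vecI) simp
  ultimately show ?thesis
    unfolding vecb_def using mu_carrier(1) by (metis append_carrier_vec zero_carrier_vec)
qed

lemma ybar_carrier: "ybar k \<in> carrier_vec M3"
  using run unfolding hot_run_def hot_sequence_def is_arg_min_def by blast

lemma limit_carrier: "xstar \<in> carrier_vec N" "zstar \<in> carrier_vec N"
  "xbar k \<in> carrier_vec N" "zbar k \<in> carrier_vec N"
  using run unfolding hot_run_def vtendsto_def by blast+

lemma init_carrier: "x 0 \<in> carrier_vec N" "z 0 \<in> carrier_vec N" "y 0 \<in> carrier_vec M3"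
  using run unfolding hot_run_def hot_sequence_def by blast+

lemma x_Suc: "x (Suc k) = (1 / real (k + 2)) \<cdot>\<^sub>v x 0
    + (real (k + 1) / real (k + 2)) \<cdot>\<^sub>v (2 \<cdot>\<^sub>v xbar k - x k)"
  using run unfolding hot_run_def hot_sequence_def by blast

lemma z_Suc: "z (Suc k) = (1 / real (k + 2)) \<cdot>\<^sub>v z 0
    + (real (k + 1) / real (k + 2)) \<cdot>\<^sub>v (2 \<cdot>\<^sub>v zbar k - z k)"
  using run unfolding hot_run_def hot_sequence_def by blast

lemma iterate_carrier: "x k \<in> carrier_vec N" "z k \<in> carrier_vec N"
  by (induction k) (auto simp: init_carrier limit_carrier x_Suc z_Suc)

definition AT :: "nat \<Rightarrow> real vec" where
  "AT k = transpose_mat A *\<^sub>v ybar k"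

lemma AT_carrier: "AT k \<in> carrier_vec N"
  using A_carrier ybar_carrier by (simp add: AT_def)

lemma dims [simp]:
  "dim_vec (AT k) = N" "dim_vec (x k) = N" "dim_vec (z k) = N" "dim_vec (xbar k) = N"
  "dim_vec (zbar k) = N" "dim_vec c = N" "dim_vec xstar = N" "dim_vec zstar = N"
  using AT_carrier[of k] iterate_carrier[of k] limit_carrier(1,2) limit_carrier(3,4)[of k]
    vecc_carrier[of m n] by auto

lemma xbar_eq: "xbar k = x k + \<sigma> \<cdot>\<^sub>v (AT k + z k - c)"
  using run unfolding hot_run_def hot_sequence_def AT_def by blast

text \<open>The gradient of the y-subproblem at \<open>ybar k\<close> is h = \<sigma> A v - b, and
  \<open>xbar k\<close> = \<sigma> v, so stationarity is feasibility. Moving from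
  \<open>ybar k\<close> in the direction h itself makes the linear coefficient the squared norm of
  h.\<close>

lemma primal_feasible: "A *\<^sub>v xbar k = b"
proof -
  define v where "v = AT k + z k - c + (1 / \<sigma>) \<cdot>\<^sub>v x k"
  define Av where "Av = A *\<^sub>v v"
  define h where "h = \<sigma> \<cdot>\<^sub>v Av - b"
  define w where "w = transpose_mat A *\<^sub>v h"
  note carriers = AT_carrier[of k] iterate_carrier[of k] vecc_carrier[of m n] A_carrier b_carrier
    ybar_carrier[of k]
  have v: "v \<in> carrier_vec N" using carriers unfolding v_def by simp
  have Av: "Av \<in> carrier_vec M3" using v carriers unfolding Av_def by simp
  have h: "h \<in> carrier_vec M3" using Av carriers unfolding h_def by simp
  have w: "w \<in> carrier_vec N" using h carriers unfolding w_def by simp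
  have min: "aug_lagr_finite m n \<mu>1 \<mu>2 \<sigma> (ybar k) (z k) (x k)
      \<le> aug_lagr_finite m n \<mu>1 \<mu>2 \<sigma> u (z k) (x k)" if "u \<in> carrier_vec M3" for u
    using run that unfolding hot_run_def hot_sequence_def is_arg_min_def by (meson not_less)
  have "(\<Sum>r<M3. (h $ r)\<^sup>2) = 0"
  proof (rule linear_coeff_eq_0)
    fix t :: real
    have "transpose_mat A *\<^sub>v (ybar k + t \<cdot>\<^sub>v h) = AT k + t \<cdot>\<^sub>v w"
      using carriers h unfolding w_def AT_def
      by (simp add: mult_add_distrib_mat_vec[of _ N M3] mult_mat_vec[of _ N M3])
    then have "transpose_mat A *\<^sub>v (ybar k + t \<cdot>\<^sub>v h) + z k - c + (1 / \<sigma>) \<cdot>\<^sub>v x k = v + t \<cdot>\<^sub>v w"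
      using carriers v w by (intro eq_vecI) (auto simp: v_def)
    moreover have "(vnorm (v + t \<cdot>\<^sub>v w))\<^sup>2
        = (vnorm v)\<^sup>2 + 2 * t * (\<Sum>i<N. v $ i * w $ i) + t\<^sup>2 * (\<Sum>i<N. (w $ i)\<^sup>2)"
      using v w by (simp add: vnorm_sq[of _ N] power2_sum power_mult_distrib sum.distrib
          sum_distrib_left algebra_simps)
    moreover have "b \<bullet> (ybar k + t \<cdot>\<^sub>v h) = b \<bullet> ybar k + t * (\<Sum>r<M3. b $ r * h $ r)"
      using carriers h by (simp add: scalar_prod_sum[of _ M3] sum.distrib sum_distrib_left algebra_simps)
    ultimately have "0 \<le> - t * (\<Sum>r<M3. b $ r * h $ r)
        + \<sigma> / 2 * (2 * t * (\<Sum>i<N. v $ i * w $ i) + t\<^sup>2 * (\<Sum>i<N. (w $ i)\<^sup>2))"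
      using min[of "ybar k + t \<cdot>\<^sub>v h"] carriers h
      unfolding aug_lagr_finite_def AT_def[symmetric] v_def[symmetric] by (simp add: algebra_simps)
    moreover have "(\<Sum>i<N. v $ i * w $ i) = (\<Sum>r<M3. Av $ r * h $ r)"
    proof -
      have "(\<Sum>i<N. v $ i * w $ i) = (transpose_mat A *\<^sub>v h) \<bullet> v"
        using v by (simp add: scalar_prod_sum[of _ N] w_def mult.commute)
      also have "\<dots> = h \<bullet> (A *\<^sub>v v)"
        by (rule transpose_vec_mult_scalar[OF A_carrier v h])
      finally show ?thesis using Av by (simp add: scalar_prod_sum[of _ M3] mult.commute Av_def[symmetric])
    qed
    ultimately have "0 \<le> t * (\<sigma> * (\<Sum>r<M3. Av $ r * h $ r) - (\<Sum>r<M3. b $ r * h $ r))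
        + t\<^sup>2 * (\<sigma> / 2 * (\<Sum>i<N. (w $ i)\<^sup>2))"
      by (simp add: algebra_simps)
    moreover have "(\<Sum>r<M3. (h $ r)\<^sup>2)
        = \<sigma> * (\<Sum>r<M3. Av $ r * h $ r) - (\<Sum>r<M3. b $ r * h $ r)"
      unfolding sum_distrib_left sum_subtractf[symmetric]
    proof (rule sum.cong[OF refl])
      fix r assume "r \<in> {..<M3}"
      then have "h $ r = \<sigma> * Av $ r - b $ r"
        using Av b_carrier unfolding h_def by simp
      then have "(h $ r)\<^sup>2 = (\<sigma> * Av $ r - b $ r) * h $ r"
        by (simp only: power2_eq_square)
      then show "(h $ r)\<^sup>2 = \<sigma> * (Av $ r * h $ r) - b $ r * h $ r"
        by (simp only: left_diff_distrib mult.assoc)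
    qed
    ultimately show "0 \<le> t * (\<Sum>r<M3. (h $ r)\<^sup>2) + t\<^sup>2 * (\<sigma> / 2 * (\<Sum>i<N. (w $ i)\<^sup>2))"
      by simp
  qed (use sigma in \<open>simp add: sum_nonneg\<close>)
  then have "\<forall>r<M3. h $ r = 0" by (subst (asm) sum_nonneg_eq_0_iff) auto
  then have "\<sigma> \<cdot>\<^sub>v Av = b"
    using Av b_carrier by (intro eq_vecI) (auto simp: h_def)
  moreover have "xbar k = \<sigma> \<cdot>\<^sub>v v"
    unfolding xbar_eq v_def using carriers sigma
    by (intro eq_vecI) (auto simp: algebra_simps)
  ultimately show ?thesis using v A_carrier by (simp add: mult_mat_vec[of _ M3 N] Av_def)
qed

definition U :: "nat \<Rightarrow> nat \<Rightarrow> real" where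
  "U k i = x k $ i + \<sigma> * z k $ i"

definition Ubar :: "nat \<Rightarrow> nat \<Rightarrow> real" where
  "Ubar k i = xbar k $ i + \<sigma> * zbar k $ i"

lemma xbar_index: "i < N \<Longrightarrow> xbar k $ i = U k i + \<sigma> * (AT k $ i - c $ i)"
  unfolding xbar_eq[of k] U_def
  using AT_carrier[of k] iterate_carrier[of k] vecc_carrier[of m n]
  by (simp add: algebra_simps)

text \<open>After completing the square, the augmented Lagrangian in z is a constant plus \<sigma> /
  2 times the squared distance to v, so the minimiser is the projection of v onto the
  orthant.\<close>

lemma zbar_eq: "zbar k = pos_part (c - AT k - (1 / \<sigma>) \<cdot>\<^sub>v xbar k)"
proof -
  define v where "v = c - AT k - (1 / \<sigma>) \<cdot>\<^sub>v xbar k"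
  note carriers = AT_carrier[of k] limit_carrier vecc_carrier[of m n]
  have v: "v \<in> carrier_vec N" using carriers unfolding v_def by simp
  have shift: "AT k + u - c + (1 / \<sigma>) \<cdot>\<^sub>v xbar k = u - v" if "u \<in> carrier_vec N" for u
    using that carriers v by (intro eq_vecI) (auto simp: v_def)
  have finite: "aug_lagr_finite m n \<mu>1 \<mu>2 \<sigma> (ybar k) u (xbar k)
      = - (b \<bullet> ybar k) + \<sigma> / 2 * (vnorm (u - v))\<^sup>2 - 1 / (2 * \<sigma>) * (vnorm (xbar k))\<^sup>2"
    if "u \<in> carrier_vec N" for u
    unfolding aug_lagr_finite_def AT_def[symmetric] shift[OF that] ..
  have min: "is_arg_min (\<lambda>u. aug_lagr m n \<mu>1 \<mu>2 \<sigma> (ybar k) u (xbar k))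
          (\<lambda>u. u \<in> carrier_vec N) (zbar k)"
    using run unfolding hot_run_def hot_sequence_def by blast
  then have le: "aug_lagr m n \<mu>1 \<mu>2 \<sigma> (ybar k) (zbar k) (xbar k)
      \<le> aug_lagr m n \<mu>1 \<mu>2 \<sigma> (ybar k) u (xbar k)" if "u \<in> carrier_vec N" for u
    using that by (auto simp: is_arg_min_def not_less)
  \<comment> \<open>The value at \<open>pos_part v\<close> is finite, which rules out a minimiser
    outside the orthant, where the value is infinite.\<close>
  have zo: "zbar k \<in> orthant N"
    using le[of "pos_part v"] pos_part_orthant[OF v]
    by (auto simp: aug_lagr_def indicator_fun_def orthant_def split: if_splits)
  have "vnorm (zbar k - v) \<le> vnorm (u - v)" if "u \<in> orthant N" for u
  proof (rule power2_le_imp_le)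
    have "u \<in> carrier_vec N" using that by (simp add: orthant_def)
    then have "\<sigma> / 2 * (vnorm (zbar k - v))\<^sup>2 \<le> \<sigma> / 2 * (vnorm (u - v))\<^sup>2"
      using le[of u] zo that carriers by (simp add: aug_lagr_def indicator_fun_def finite)
    then show "(vnorm (zbar k - v))\<^sup>2 \<le> (vnorm (u - v))\<^sup>2"
      using sigma by simp
  qed (rule vnorm_nonneg)
  then have "is_arg_min (\<lambda>u. vnorm (u - v)) (\<lambda>u. u \<in> orthant N) (zbar k)"
    using zo by (auto simp: is_arg_min_def not_less)
  then show ?thesis
    using v by (simp add: is_arg_min_orthant_iff v_def)
qed

text \<open>Since \<sigma> (c - A^T ybar) = U - xbar, the argument of the projection becomes (U - 2
  xbar) / \<sigma>. The point 2 xbar - U is the reflected point of the Douglas-Rachford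
  step.\<close>

lemma zbar_index:
  assumes "i < N"
  shows "zbar k $ i = max 0 ((U k i - 2 * xbar k $ i) / \<sigma>)"
proof -
  have "zbar k $ i = max 0 (c $ i - AT k $ i - xbar k $ i / \<sigma>)"
    unfolding zbar_eq[of k] using assms AT_carrier[of k] limit_carrier vecc_carrier[of m n]
    by (simp add: pos_part_index)
  moreover have "c $ i - AT k $ i = (U k i - xbar k $ i) / \<sigma>"
    using sigma by (simp add: xbar_index[OF assms])
  ultimately show ?thesis by (simp add: diff_divide_distrib)
qed

lemma sigma_zbar_index:
  assumes "i < N"
  shows "\<sigma> * zbar k $ i = max 0 (U k i - 2 * xbar k $ i)"
  using sigma by (simp add: zbar_index[OF assms] max_mult_distrib_left)

text \<open>Differences of feasible points lie in the kernel of A, which is orthogonal to the range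
  of A^T.\<close>

lemma AT_xbar_orthogonal: "(\<Sum>i<N. AT k $ i * (xbar k' $ i - xbar k'' $ i)) = 0"
proof -
  have "(\<Sum>i<N. AT k $ i * xbar j $ i) = ybar k \<bullet> b" for j
    using transpose_vec_mult_scalar[OF A_carrier limit_carrier(3)[of j] ybar_carrier[of k]]
    by (simp add: primal_feasible scalar_prod_sum[OF limit_carrier(3)[of j]] AT_def[symmetric])
  then show ?thesis by (simp add: right_diff_distrib sum_subtractf)
qed

sublocale halpern_iteration N U Ubar
proof
  fix i k assume "i < N"
  define p q where "p = 1 / real (k + 2)" and "q = real (k + 1) / real (k + 2)"
  have xs: "x (Suc k) $ i = p * x 0 $ i + q * (2 * xbar k $ i - x k $ i)"
    and zs: "z (Suc k) $ i = p * z 0 $ i + q * (2 * zbar k $ i - z k $ i)"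
    using \<open>i < N\<close> by (simp_all add: x_Suc z_Suc p_def q_def)
  show "U (Suc k) i = 1 / real (k + 2) * U 0 i
      + real (k + 1) / real (k + 2) * (2 * Ubar k i - U k i)"
    unfolding p_def[symmetric] q_def[symmetric] U_def Ubar_def xs zs by (simp add: algebra_simps)
next
  fix k j
  define p where "p i = max 0 (U k i - 2 * xbar k $ i) - max 0 (U j i - 2 * xbar j $ i)" for i
  define dx where "dx i = xbar k $ i - xbar j $ i" for i
  \<comment> \<open>Expanding with \<open>Ubar k i - Ubar j i\<close> = dx + p leaves a remainder p
    * (dU - 2 dx) - p * p, where dU is the difference of the U values; it is nonnegative by
    \<open>max_0_firm\<close>.\<close>
  have coord: "dx i * ((U k i - U j i) - dx i)
      \<le> ((U k i - Ubar k i) - (U j i - Ubar j i)) * (Ubar k i - Ubar j i)" if "i < N" for i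
  proof -
    have eq: "Ubar k i - Ubar j i = dx i + p i"
      using that by (simp add: Ubar_def sigma_zbar_index p_def dx_def)
    have "p i * p i \<le> p i * ((U k i - U j i) - 2 * dx i)"
      using max_0_firm[of "U k i - 2 * xbar k $ i" "U j i - 2 * xbar j $ i"]
      unfolding p_def dx_def by (simp add: algebra_simps)
    moreover have "((U k i - Ubar k i) - (U j i - Ubar j i)) * (Ubar k i - Ubar j i)
        = ((U k i - U j i) - (dx i + p i)) * (dx i + p i)"
      using eq by (simp add: algebra_simps)
    ultimately show ?thesis by (simp add: algebra_simps)
  qed
  \<comment> \<open>The part belonging to the affine projection vanishes exactly: its increments U -
    xbar lie in the range of A^T once c cancels, and dx lies in the kernel of A.\<close>
  have "(\<Sum>i<N. dx i * ((U k i - U j i) - dx i))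
      = (\<Sum>i<N. \<sigma> * (AT j $ i * dx i) - \<sigma> * (AT k $ i * dx i))"
  proof (rule sum.cong[OF refl])
    fix i assume "i \<in> {..<N}"
    then have eq: "(U k i - U j i) - dx i = \<sigma> * AT j $ i - \<sigma> * AT k $ i"
      by (simp add: dx_def xbar_index algebra_simps)
    show "dx i * ((U k i - U j i) - dx i) = \<sigma> * (AT j $ i * dx i) - \<sigma> * (AT k $ i * dx i)"
      unfolding eq by (simp add: algebra_simps)
  qed
  also have "\<dots> = 0"
    unfolding sum_subtractf sum_distrib_left[symmetric] dx_def AT_xbar_orthogonal by simp
  finally show "0 \<le> (\<Sum>i<N. ((U k i - Ubar k i) - (U j i - Ubar j i)) * (Ubar k i - Ubar j i))"
    using sum_mono[of "{..<N}" "\<lambda>i. dx i * ((U k i - U j i) - dx i)"] coord by fastforce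
qed

text \<open>The primal block vanishes by feasibility. Only the dual block carries the factor 1 /
  \<sigma>; the complementarity block is bounded by the gap itself.\<close>

lemma residual_le_gap:
  "vnorm (kkt_residual m n \<mu>1 \<mu>2 (ybar k) (zbar k) (xbar k)) \<le> (1 + \<sigma>) / \<sigma> * L2_set (gap k) {..<N}"
proof (rule power2_le_imp_le)
  note carriers = AT_carrier[of k] limit_carrier vecc_carrier[of m n] b_carrier
  have zx: "zbar k - xbar k \<in> carrier_vec N" using carriers by simp
  have dual: "(c - AT k - zbar k) $ i = gap k i / \<sigma>" if "i < N" for i
    using that carriers sigma
    by (simp add: Ubar_def xbar_index field_simps)
  \<comment> \<open>Coordinatewise the left side is min zbar xbar, and the gap is xbar + min 0 (U -
    2 xbar). For U - 2 xbar < 0 the value zbar is 0 and the extra negative term can only enlarge a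
    negative xbar; otherwise the gap is xbar and zbar is nonnegative.\<close>
  have proj: "((zbar k - pos_part (zbar k - xbar k)) $ i)\<^sup>2 \<le> (gap k i)\<^sup>2" if "i < N" for i
  proof -
    have "\<bar>(zbar k - pos_part (zbar k - xbar k)) $ i\<bar>
        = \<bar>zbar k $ i - max 0 (zbar k $ i - xbar k $ i)\<bar>"
      using that carriers zx pos_part_orthant[OF zx]
      by (simp add: pos_part_index orthant_def)
    also have "\<dots> \<le> \<bar>gap k i\<bar>"
      using sigma_zbar_index[OF that, of k] zbar_index[OF that, of k] sigma
      by (auto simp: Ubar_def max_def divide_le_0_iff zero_le_divide_iff split: if_splits)
    finally show ?thesis by (simp add: abs_le_square_iff)
  qed
  have "(vnorm (kkt_residual m n \<mu>1 \<mu>2 (ybar k) (zbar k) (xbar k)))\<^sup>2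
      = (vnorm (zbar k - pos_part (zbar k - xbar k)))\<^sup>2 + (vnorm (c - AT k - zbar k))\<^sup>2"
    using carriers zx
    by (simp add: kkt_residual_def AT_def[symmetric] vnorm_append_sq primal_feasible eucl_proj_orthant vnorm_sq[of _ M3])
  also have "\<dots> = (\<Sum>i<N. ((zbar k - pos_part (zbar k - xbar k)) $ i)\<^sup>2)
      + (\<Sum>i<N. (gap k i / \<sigma>)\<^sup>2)"
    using carriers zx pos_part_orthant[OF zx] dual
    by (simp add: vnorm_sq[of _ N] orthant_def del: index_minus_vec)
  also have "\<dots> \<le> (\<Sum>i<N. (gap k i)\<^sup>2) + (\<Sum>i<N. (gap k i / \<sigma>)\<^sup>2)"
    by (intro add_right_mono sum_mono proj) simp
  also have "\<dots> = (1 + 1 / \<sigma>\<^sup>2) * (\<Sum>i<N. (gap k i)\<^sup>2)"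
    by (simp add: power_divide sum_divide_distrib[symmetric] algebra_simps)
  \<comment> \<open>The two sides differ by the cross term 2 / \<sigma>; this is the origin of the
    factor (1 + \<sigma>) / \<sigma>.\<close>
  also have "\<dots> \<le> ((1 + \<sigma>) / \<sigma>)\<^sup>2 * (\<Sum>i<N. (gap k i)\<^sup>2)"
  proof (rule mult_right_mono)
    show "1 + 1 / \<sigma>\<^sup>2 \<le> ((1 + \<sigma>) / \<sigma>)\<^sup>2"
      using sigma by (simp add: field_simps power2_eq_square)
  qed (simp add: sum_nonneg)
  finally show "(vnorm (kkt_residual m n \<mu>1 \<mu>2 (ybar k) (zbar k) (xbar k)))\<^sup>2
      \<le> ((1 + \<sigma>) / \<sigma> * L2_set (gap k) {..<N})\<^sup>2"
    by (simp only: power_mult_distrib L2_set_sq)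
qed (use sigma in \<open>simp add: L2_set_nonneg\<close>)

text \<open>\<open>hot_const\<close> arises by splitting u_0 - us into its x and z parts with the
  triangle inequality. The bound is kept for the gap because the program tests the gap, not the
  residual.\<close>

lemma gap_rate:
  "(1 + \<sigma>) / \<sigma> * L2_set (gap k) {..<N} \<le> hot_const \<sigma> (x 0) (z 0) xstar zstar / real (k + 1)"
proof -
  define us where "us i = xstar $ i + \<sigma> * zstar $ i" for i
  have "(\<lambda>k. Ubar k i) \<longlonglongrightarrow> us i" if "i < N" for i
    unfolding Ubar_def us_def using run that
    by (intro tendsto_intros vtendsto_index[of N]) (auto simp: hot_run_def)
  then have "real (k + 1) * L2_set (gap k) {..<N} \<le> L2_set (\<lambda>i. U 0 i - us i) {..<N}"
    by (rule rate)
  also have "\<dots> = L2_set (\<lambda>i. (x 0 - xstar) $ i + \<sigma> * (z 0 - zstar) $ i) {..<N}"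
    using init_carrier limit_carrier
    by (intro L2_set_cong) (auto simp: U_def us_def algebra_simps)
  also have "\<dots> \<le> L2_set (\<lambda>i. (x 0 - xstar) $ i) {..<N} + L2_set (\<lambda>i. \<sigma> * (z 0 - zstar) $ i) {..<N}"
    by (rule L2_set_triangle_ineq)
  also have "\<dots> = vnorm (x 0 - xstar) + \<sigma> * vnorm (z 0 - zstar)"
    using init_carrier limit_carrier sigma
    by (simp add: vnorm_eq_L2_set[of _ N] L2_set_right_distrib del: index_minus_vec)
  finally have "(1 + \<sigma>) / \<sigma> * (real (k + 1) * L2_set (gap k) {..<N})
      \<le> (1 + \<sigma>) / \<sigma> * (vnorm (x 0 - xstar) + \<sigma> * vnorm (z 0 - zstar))"
    using sigma by (intro mult_left_mono) auto
  then have "(1 + \<sigma>) / \<sigma> * L2_set (gap k) {..<N} * real (k + 1)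
      \<le> hot_const \<sigma> (x 0) (z 0) xstar zstar"
    by (simp only: hot_const_def mult_ac)
  then show ?thesis by (simp add: pos_le_divide_eq)
qed

lemma gap_le_tolerance:
  assumes "0 < \<epsilon>" and k: "1 / \<epsilon> * hot_const \<sigma> (x 0) (z 0) xstar zstar - 1 \<le> real k"
  shows "(1 + \<sigma>) / \<sigma> * L2_set (gap k) {..<N} \<le> \<epsilon>"
proof -
  have "hot_const \<sigma> (x 0) (z 0) xstar zstar / real (k + 1) \<le> \<epsilon>"
    using assms by (simp add: field_simps)
  with gap_rate[of k] show ?thesis by linarith
qed

end

section \<open>Straight-line programs\<close>

text \<open>From the values S, the set T becomes available after k instructions. A value is a
  function of the initial state, and sets of available values make reuse of an earlier result
  free.\<close>

inductive slp :: "('s \<Rightarrow> real) set \<Rightarrow> nat \<Rightarrow> ('s \<Rightarrow> real) set \<Rightarrow> bool" for S where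
  start: "slp S 0 S"
| const: "slp S k T \<Longrightarrow> slp S (Suc k) (insert (\<lambda>_. real c) T)"
| arith: "slp S k T \<Longrightarrow> f \<in> T \<Longrightarrow> g \<in> T \<Longrightarrow>
    slp S (Suc k) (insert (\<lambda>s. apply_op p (f s) (g s)) T)"

lemma slp_union: "slp S k T \<Longrightarrow> slp (S \<union> R) k (T \<union> R)"
proof (induction rule: slp.induct)
  case (const k T c)
  then show ?case using slp.const[of "S \<union> R" k "T \<union> R" c] by simp
next
  case (arith k T f g p)
  then show ?case using slp.arith[of "S \<union> R" k "T \<union> R" f g p] by simp
qed (rule slp.start)

lemma slp_trans: "slp T l V \<Longrightarrow> slp S k T \<Longrightarrow> slp S (k + l) V"
  by (induction rule: slp.induct) (auto intro: slp.intros)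

lemma slp_subset: "slp S k T \<Longrightarrow> S \<subseteq> T"
  by (induction rule: slp.induct) auto

definition slp_le :: "('s \<Rightarrow> real) set \<Rightarrow> nat \<Rightarrow> ('s \<Rightarrow> real) set \<Rightarrow> bool" where
  "slp_le S L T \<longleftrightarrow> (\<exists>k\<le>L. \<exists>T'. slp S k T' \<and> T \<subseteq> T')"

lemma slp_le_refl: "T \<subseteq> S \<Longrightarrow> slp_le S L T"
  unfolding slp_le_def using slp.start by blast

lemma slp_le_start: "slp_le S L T \<Longrightarrow> slp_le S L (S \<union> T)"
  unfolding slp_le_def using slp_subset by (metis Un_subset_iff)

text \<open>The second computation may use everything that the first made available, so shared
  subresults are charged once.\<close>

lemma slp_le_trans:
  assumes "slp_le S a T" "slp_le (S \<union> T) b V"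
  shows "slp_le S (a + b) V"
proof -
  obtain k T' where k: "k \<le> a" "slp S k T'" "T \<subseteq> T'"
    using assms(1) by (auto simp: slp_le_def)
  obtain l V' where l: "l \<le> b" "slp (S \<union> T) l V'" "V \<subseteq> V'"
    using assms(2) by (auto simp: slp_le_def)
  have "S \<union> T \<union> T' = T'" using k slp_subset by blast
  with slp_union[OF l(2), of T'] have "slp T' l (V' \<union> T')" by simp
  then have "slp S (k + l) (V' \<union> T')" using k(2) by (rule slp_trans)
  then show ?thesis
    unfolding slp_le_def using k(1) l(1,3) by (meson add_mono le_supI1)
qed

lemma slp_le_mono:
  assumes "slp_le S a T" "S \<subseteq> S'" "a \<le> b" "T' \<subseteq> T"
  shows "slp_le S' b T'"
proof -
  obtain k V where "k \<le> a" "slp S k V" "T \<subseteq> V"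
    using assms(1) by (auto simp: slp_le_def)
  moreover from this have "slp S' k (V \<union> S')"
    using slp_union[of S k V S'] assms(2) by (simp add: Un_absorb1)
  ultimately show ?thesis
    unfolding slp_le_def using assms(3,4) by (meson le_supI1 order_trans)
qed

section \<open>Cost rules for single values\<close>

abbreviation evaluates :: "('s \<Rightarrow> real) set \<Rightarrow> nat \<Rightarrow> ('s \<Rightarrow> real) \<Rightarrow> bool" where
  "evaluates S L f \<equiv> slp_le S L {f}"

lemma evaluates_mem: "f \<in> S \<Longrightarrow> evaluates S 0 f"
  by (rule slp_le_refl) simp

lemma evaluates_real: "evaluates S 1 (\<lambda>s. real c)"
proof -
  have "slp S 1 (insert (\<lambda>s. real c) S)" using slp.const[OF slp.start] by simp
  then show ?thesis unfolding slp_le_def by blast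
qed

lemma evaluates_0: "evaluates S 1 (\<lambda>s. 0)"
  using evaluates_real[of S 0] by simp

lemma evaluates_1: "evaluates S 1 (\<lambda>s. 1)"
  using evaluates_real[of S 1] by simp

lemma evaluates_numeral: "evaluates S 1 (\<lambda>s. numeral w)"
  using evaluates_real[of S "numeral w"] by simp

lemma evaluates_apply_op:
  assumes f: "evaluates S a f" and g: "evaluates S b g"
  shows "evaluates S (a + b + 1) (\<lambda>s. apply_op p (f s) (g s))"
proof -
  have "slp_le (S \<union> {f}) b (S \<union> {f} \<union> {g})"
    by (rule slp_le_start, rule slp_le_mono[OF g]) auto
  with f have 1: "slp_le S (a + b) (S \<union> {f} \<union> {g})" by (rule slp_le_trans)
  let ?V = "S \<union> (S \<union> {f} \<union> {g})"
  have "slp ?V 1 (insert (\<lambda>s. apply_op p (f s) (g s)) ?V)"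
    using slp.arith[OF slp.start, of f ?V g p] by simp
  then have "evaluates ?V 1 (\<lambda>s. apply_op p (f s) (g s))"
    unfolding slp_le_def by blast
  with 1 show ?thesis by (rule slp_le_trans)
qed

lemmas evaluates_plus = evaluates_apply_op[where p = Plus, unfolded apply_op.simps]
lemmas evaluates_minus = evaluates_apply_op[where p = Minus, unfolded apply_op.simps]
lemmas evaluates_times = evaluates_apply_op[where p = Times, unfolded apply_op.simps]
lemmas evaluates_divide = evaluates_apply_op[where p = Divide, unfolded apply_op.simps]
lemmas evaluates_max = evaluates_apply_op[where p = Maximum, unfolded apply_op.simps]

text \<open>The argument is computed once and serves as both factors, so its cost is not
  doubled.\<close>

lemma evaluates_power2:
  assumes "evaluates S a f"
  shows "evaluates S (a + 1) (\<lambda>s. (f s)\<^sup>2)"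
proof -
  have "evaluates (S \<union> {f}) (0 + 0 + 1) (\<lambda>s. f s * f s)"
    by (intro evaluates_times evaluates_mem) auto
  with assms show ?thesis
    using slp_le_trans[of S a "{f}" 1] by (simp add: power2_eq_square)
qed

text \<open>P does not depend on the state: it is decided when the code is generated, and no branch
  instruction is involved.\<close>

lemma evaluates_if:
  assumes "P \<Longrightarrow> evaluates S a f" "\<not> P \<Longrightarrow> evaluates S b g"
  shows "evaluates S (a + b) (\<lambda>s. if P then f s else g s)"
proof (cases P)
  case True
  then show ?thesis using slp_le_mono[OF assms(1)[OF True], of S "a + b"] by simp
next
  case False
  then show ?thesis using slp_le_mono[OF assms(2)[OF False], of S "a + b"] by simp
qed

lemma evaluates_sum:
  assumes "\<And>i. i < n \<Longrightarrow> evaluates S a (f i)"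
  shows "evaluates S (n * (a + 1) + 1) (\<lambda>s. \<Sum>i<n. f i s)"
  using assms
proof (induction n)
  case 0
  then show ?case by (simp add: evaluates_0[simplified])
next
  case (Suc n)
  have "evaluates S ((n * (a + 1) + 1) + a + 1) (\<lambda>s. (\<Sum>i<n. f i s) + f n s)"
    by (intro evaluates_plus Suc) auto
  then show ?case by (simp add: algebra_simps)
qed

lemma slp_le_family:
  assumes "finite I" "\<And>i. i \<in> I \<Longrightarrow> evaluates S a (f i)"
  shows "slp_le S (card I * a) (S \<union> f ` I)"
  using assms
proof (induction I rule: finite_induct)
  case empty
  then show ?case by (simp add: slp_le_refl)
next
  case (insert x I)
  have "evaluates (S \<union> (S \<union> f ` I)) a (f x)"
    by (rule slp_le_mono[OF insert.prems]) auto
  then have "slp_le (S \<union> (S \<union> f ` I)) a (S \<union> (S \<union> f ` I) \<union> {f x})"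
    by (rule slp_le_start)
  moreover have "slp_le S (card I * a) (S \<union> f ` I)"
    by (rule insert.IH) (use insert.prems in blast)
  ultimately have "slp_le S (card I * a + a) (S \<union> (S \<union> f ` I) \<union> {f x})"
    by (intro slp_le_trans)
  then show ?case
    by (rule slp_le_mono) (use insert.hyps in \<open>auto simp: algebra_simps\<close>)
qed

lemma slp_le_stage:
  assumes "slp_le S L T" "finite I" "\<And>i. i \<in> I \<Longrightarrow> evaluates T a (f i)"
  shows "slp_le S (L + card I * a) (T \<union> f ` I)"
proof -
  have "slp_le (S \<union> T) (card I * a) (T \<union> f ` I)"
    by (rule slp_le_mono[OF slp_le_family[OF assms(2,3)]]) auto
  with assms(1) show ?thesis by (rule slp_le_trans)
qed

section \<open>Compilation to register code\<close>

lemma exec_Nil [simp]: "exec [] r = r"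
  by (simp add: exec_def)

lemma exec_append: "exec (is @ js) r = exec js (exec is r)"
  by (simp add: exec_def)

lemma exec_snoc: "exec (is @ [i]) r = exec_instr i (exec is r)"
  by (simp add: exec_def)

text \<open>Each instruction writes to the fresh register B + k, so nothing is overwritten and every
  available value keeps a fixed address.\<close>

lemma slp_compile:
  assumes "slp {\<lambda>r. r a |a. a < B} k T"
  shows "\<exists>is. length is = k \<and> (\<forall>r. \<forall>a<B. exec is r a = r a) \<and>
    (\<forall>f\<in>T. \<exists>a<B + k. \<forall>r. exec is r a = f r)"
  using assms
proof (induction rule: slp.induct)
  case start
  show ?case by (rule exI[of _ "[]"]) auto
next
  case (const k T c)
  then obtain "is" where IH: "length is = k" "\<forall>r. \<forall>a<B. exec is r a = r a"
    "\<forall>f\<in>T. \<exists>a<B + k. \<forall>r. exec is r a = f r" by blast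
  define js where "js = is @ [Const (B + k) c]"
  have js: "exec js r = (exec is r)(B + k := real c)" for r
    by (simp add: js_def exec_snoc)
  have "\<exists>a<B + Suc k. \<forall>r. exec js r a = f r" if "f \<in> T" for f
  proof -
    obtain a where "a < B + k" "\<forall>r. exec is r a = f r" using IH(3) \<open>f \<in> T\<close> by blast
    then show ?thesis by (intro exI[of _ a]) (simp add: js)
  qed
  moreover have "\<exists>a<B + Suc k. \<forall>r. exec js r a = real c"
    by (rule exI[of _ "B + k"]) (simp add: js)
  moreover have "length js = Suc k" "\<forall>r. \<forall>a<B. exec js r a = r a"
    using IH(1,2) by (simp add: js_def, simp add: js)
  ultimately show ?case by (intro exI[of _ js]) simp
next
  case (arith k T f g p)
  then obtain "is" where IH: "length is = k" "\<forall>r. \<forall>a<B. exec is r a = r a"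
    "\<forall>f\<in>T. \<exists>a<B + k. \<forall>r. exec is r a = f r" by blast
  obtain af ag where af: "\<forall>r. exec is r af = f r" and ag: "\<forall>r. exec is r ag = g r"
    using IH(3) arith.hyps by meson
  define js where "js = is @ [Arith p (B + k) af ag]"
  have js: "exec js r = (exec is r)(B + k := apply_op p (f r) (g r))" for r
    using af ag by (simp add: js_def exec_snoc)
  have "\<exists>a<B + Suc k. \<forall>r. exec js r a = h r" if "h \<in> T" for h
  proof -
    obtain a where "a < B + k" "\<forall>r. exec is r a = h r" using IH(3) \<open>h \<in> T\<close> by blast
    then show ?thesis by (intro exI[of _ a]) (simp add: js)
  qed
  moreover have "\<exists>a<B + Suc k. \<forall>r. exec js r a = apply_op p (f r) (g r)"
    by (rule exI[of _ "B + k"]) (simp add: js)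
  moreover have "length js = Suc k" "\<forall>r. \<forall>a<B. exec js r a = r a"
    using IH(1,2) by (simp add: js_def, simp add: js)
  ultimately show ?case by (intro exI[of _ js]) simp
qed

text \<open>The instruction set has no move; \<open>max a a = a\<close> serves as one.\<close>

definition copy_block :: "nat \<Rightarrow> (nat \<Rightarrow> nat) \<Rightarrow> nat \<Rightarrow> instr list" where
  "copy_block d src q = map (\<lambda>i. Arith Maximum (d + i) (src i) (src i)) [0..<q]"

lemma length_copy_block [simp]: "length (copy_block d src q) = q"
  by (simp add: copy_block_def)

text \<open>With all sources outside the destination block, the sequential copies act like a
  simultaneous assignment.\<close>

lemma exec_copy_block:
  assumes "\<And>i. i < q \<Longrightarrow> src i < d \<or> d + q \<le> src i"
  shows "exec (copy_block d src q) r =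
    (\<lambda>a. if d \<le> a \<and> a < d + q then r (src (a - d)) else r a)"
  using assms
proof (induction q)
  case (Suc q)
  have IH: "exec (copy_block d src q) r =
    (\<lambda>a. if d \<le> a \<and> a < d + q then r (src (a - d)) else r a)"
  proof (rule Suc.IH)
    fix i assume "i < q"
    with Suc.prems[of i] show "src i < d \<or> d + q \<le> src i" by auto
  qed
  have "copy_block d src (Suc q) = copy_block d src q @ [Arith Maximum (d + q) (src q) (src q)]"
    by (simp add: copy_block_def)
  then show ?case
    using Suc.prems[of q] by (auto simp: exec_snoc IH fun_eq_iff le_Suc_eq less_Suc_eq)
qed (auto simp: copy_block_def)

text \<open>Turns a computation into an update in place of the registers from D to B - 1. A source
  may itself lie in that block, so the values pass through scratch registers from B + k on; the two
  copies account for 2 * (B - D).\<close>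

lemma slp_le_compile_block:
  assumes slp: "slp_le {\<lambda>r. r a |a. a < B} L T" and "D \<le> B"
    and F: "\<And>a. D \<le> a \<Longrightarrow> a < B \<Longrightarrow> F a \<in> T"
  shows "\<exists>is. length is \<le> L + 2 * (B - D) \<and>
    (\<forall>r. \<forall>a<D. exec is r a = r a) \<and> (\<forall>r a. D \<le> a \<longrightarrow> a < B \<longrightarrow> exec is r a = F a r)"
proof -
  obtain k T' where k: "k \<le> L" "slp {\<lambda>r. r a |a. a < B} k T'" "T \<subseteq> T'"
    using slp by (auto simp: slp_le_def)
  obtain "is" where len: "length is = k" and keep: "\<forall>r. \<forall>a<B. exec is r a = r a"
    and val: "\<forall>f\<in>T'. \<exists>a<B + k. \<forall>r. exec is r a = f r"
    using slp_compile[OF k(2)] by blast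
  define q where "q = B - D"
  have ex: "\<exists>a. i < q \<longrightarrow> a < B + k \<and> (\<forall>r. exec is r a = F (D + i) r)" for i
  proof (cases "i < q")
    case True
    then have "F (D + i) \<in> T'" using F[of "D + i"] k(3) by (auto simp: q_def)
    with val show ?thesis by blast
  qed simp
  have "\<exists>src. \<forall>i. i < q \<longrightarrow> src i < B + k \<and> (\<forall>r. exec is r (src i) = F (D + i) r)"
    by (intro choice allI ex)
  then obtain src where src: "\<And>i. i < q \<Longrightarrow> src i < B + k"
      "\<And>i r. i < q \<Longrightarrow> exec is r (src i) = F (D + i) r"
    by blast
  define js where
    "js = is @ copy_block (B + k) src q @ copy_block D (\<lambda>i. B + k + i) q"
  have "exec js r a = (if D \<le> a \<and> a < B then F a r else r a)" if "a < B" for r a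
  proof -
    have 1: "exec (copy_block (B + k) src q) r' =
        (\<lambda>a. if B + k \<le> a \<and> a < B + k + q then r' (src (a - (B + k))) else r' a)" for r'
      by (rule exec_copy_block) (use src in auto)
    have 2: "exec (copy_block D (\<lambda>i. B + k + i) q) r' =
        (\<lambda>a. if D \<le> a \<and> a < D + q then r' (B + k + (a - D)) else r' a)" for r'
      by (rule exec_copy_block) (use \<open>D \<le> B\<close> in \<open>auto simp: q_def\<close>)
    show ?thesis
      unfolding js_def exec_append 1 2
      using that keep src(2)[of "a - D"] \<open>D \<le> B\<close> by (auto simp: q_def)
  qed
  then show ?thesis
    using k(1) len \<open>D \<le> B\<close> by (intro exI[of _ js]) (auto simp: js_def q_def)
qed

section \<open>One pass of the algorithm\<close>

text \<open>Makes each cost entry a constant that one instruction can load. The sum of the two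
  truncated differences is the absolute difference.\<close>

lemma vecc_nat:
  assumes "i < dimN m n"
  shows "\<exists>a. vecc m n $ i = real a"
proof -
  have "\<exists>d::nat. (real a - real b)\<^sup>2 = real d" for a b
  proof -
    have "(real a - real b)\<^sup>2 = real ((a - b + (b - a))\<^sup>2)"
      by (cases "a \<le> b") (auto simp: of_nat_diff power2_commute)
    then show ?thesis by blast
  qed
  then show ?thesis
    using assms by (auto simp: vecc_def dimN_def)
qed

text \<open>The equation \<open>A A\<^sup>T y = r\<close> reads, for
  the three blocks \<open>p, q, t\<close> of \<open>y\<close> and with \<open>t\<close> extended by \<open>0\<close> to the omitted last row,
  \<open>(m + n) p\<^sub>k\<^sub>j + \<Sum>\<^sub>i q\<^sub>i\<^sub>j - \<Sum>\<^sub>l t\<^sub>k\<^sub>l = R1\<close>, \<open>m q\<^sub>i\<^sub>j + \<Sum>\<^sub>k p\<^sub>k\<^sub>j = R2\<close>, \<open>n t\<^sub>k\<^sub>l - \<Sum>\<^sub>j p\<^sub>k\<^sub>j = R3\<close>. Eliminating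
  \<open>q\<close> and \<open>t\<close> leaves an equation for \<open>p\<close> in which only the row sums, the column sums and the total
  sum of \<open>p\<close> are coupled, so these sums are found first.\<close>

locale hot_pass =
  fixes m n :: nat and sg :: "'s \<Rightarrow> real" and mu1 mu2 u :: "nat \<Rightarrow> 's \<Rightarrow> real"
  assumes m: "0 < m" and n: "0 < n"
begin

abbreviation "fl1 \<equiv> flow1 m"
abbreviation "fl2 \<equiv> flow2 m n"
abbreviation "N \<equiv> dimN m n"
abbreviation "M \<equiv> dimM m n"

definition w :: "nat \<Rightarrow> 's \<Rightarrow> real" where
  "w i s = u i s - sg s * vecc m n $ i"

text \<open>\<open>R1\<close>, \<open>R2\<close> and \<open>R3\<close> are the blocks of (b - A w) /
  \<sigma>. Feasibility of xbar = w + \<sigma> A^T ybar says that A A^T ybar equals this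
  vector.\<close>

definition R1 :: "nat \<Rightarrow> nat \<Rightarrow> 's \<Rightarrow> real" where
  "R1 k j s = ((\<Sum>l<n. w (fl2 k j l) s) - (\<Sum>i<m. w (fl1 i k j) s)) / sg s"

definition R2 :: "nat \<Rightarrow> nat \<Rightarrow> 's \<Rightarrow> real" where
  "R2 i j s = (mu1 (i + m * j) s - (\<Sum>k<m. w (fl1 i k j) s)) / sg s"

definition R3 :: "nat \<Rightarrow> nat \<Rightarrow> 's \<Rightarrow> real" where
  "R3 k l s = (if k + m * l < M - 1
     then (mu2 (k + m * l) s - (\<Sum>j<n. w (fl2 k j l) s)) / sg s else 0)"

definition a2 :: "nat \<Rightarrow> 's \<Rightarrow> real" where
  "a2 j s = (\<Sum>i<m. R2 i j s) / real m"

definition a3 :: "nat \<Rightarrow> 's \<Rightarrow> real" where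
  "a3 k s = (\<Sum>l<n. R3 k l s) / real n"

text \<open>Right side of the equation for p after q and t are eliminated: the sum of q over i
  contributes \<open>a2\<close>, the sum of t over l contributes \<open>a3\<close>.\<close>

definition W :: "nat \<Rightarrow> nat \<Rightarrow> 's \<Rightarrow> real" where
  "W k j s = R1 k j s - a2 j s + a3 k s"

definition Wcol :: "nat \<Rightarrow> 's \<Rightarrow> real" where
  "Wcol j s = (\<Sum>k<m. W k j s)"

definition Wrow :: "nat \<Rightarrow> 's \<Rightarrow> real" where
  "Wrow k s = (\<Sum>j<n. W k j s)"

definition Wtot :: "'s \<Rightarrow> real" where
  "Wtot s = (\<Sum>k<m. Wrow k s)"

text \<open>Total sum of p, obtained by solving the row-sum equation at k = m - 1, in which that row
  sum is already known to be \<open>Wtot\<close>.\<close>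

definition ptot :: "'s \<Rightarrow> real" where
  "ptot s = real (m + 1) * Wtot s - Wrow (m - 1) s"

definition pcol :: "nat \<Rightarrow> 's \<Rightarrow> real" where
  "pcol j s = (Wcol j s + ptot s - Wtot s / real n) / real n"

definition prow :: "nat \<Rightarrow> 's \<Rightarrow> real" where
  "prow k s = (Wrow k s + ptot s - (if k = m - 1 then Wtot s else 0)) / real m"

definition p :: "nat \<Rightarrow> nat \<Rightarrow> 's \<Rightarrow> real" where
  "p k j s = (W k j s + pcol j s + prow k s - (if k = m - 1 then Wtot s / real n else 0))
     / real (m + n)"

definition q :: "nat \<Rightarrow> nat \<Rightarrow> 's \<Rightarrow> real" where
  "q i j s = (R2 i j s - pcol j s) / real m"

definition t :: "nat \<Rightarrow> nat \<Rightarrow> 's \<Rightarrow> real" where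
  "t k l s = (if k + m * l < M - 1 then (R3 k l s + prow k s) / real n else 0)"

lemma not_last_iff:
  assumes "k < m" "l < n"
  shows "k + m * l < M - 1 \<longleftrightarrow> \<not> (k = m - 1 \<and> l = n - 1)"
proof -
  have "k + m * l < m * n" by (rule mixed_radix_less[OF assms])
  moreover have "m * n - 1 = (m - 1) + m * (n - 1)"
  proof -
    have "m * n = m * (n - 1) + m" using n by (cases n) auto
    then show ?thesis using m by simp
  qed
  moreover have "k + m * l = (m - 1) + m * (n - 1) \<longleftrightarrow> k = m - 1 \<and> l = n - 1"
    using assms m by (intro mixed_radix_eq_iff) auto
  ultimately show ?thesis unfolding dimM_def by linarith
qed

text \<open>The run supplies a solution as its minimiser; forcing every solution to equal the
  formulas identifies it with the computed one.\<close>

lemma normal_equations_unique: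
  fixes pp qq tt :: "nat \<Rightarrow> nat \<Rightarrow> real"
  assumes E1: "\<And>k j. k < m \<Longrightarrow> j < n \<Longrightarrow>
      real (m + n) * pp k j + (\<Sum>i<m. qq i j) - (\<Sum>l<n. tt k l) = R1 k j s"
    and E2: "\<And>i j. i < m \<Longrightarrow> j < n \<Longrightarrow> real m * qq i j + (\<Sum>k<m. pp k j) = R2 i j s"
    and E3: "\<And>k l. k < m \<Longrightarrow> l < n \<Longrightarrow> k + m * l < M - 1 \<Longrightarrow>
      real n * tt k l - (\<Sum>j<n. pp k j) = R3 k l s"
    and last: "\<And>k l. \<not> k + m * l < M - 1 \<Longrightarrow> tt k l = 0"
  shows "k < m \<Longrightarrow> j < n \<Longrightarrow> pp k j = p k j s"
    and "i < m \<Longrightarrow> j < n \<Longrightarrow> qq i j = q i j s"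
    and "k < m \<Longrightarrow> l < n \<Longrightarrow> tt k l = t k l s"
proof -
  define col row where "col j = (\<Sum>k<m. pp k j)" and "row k = (\<Sum>j<n. pp k j)" for j k
  define tot where "tot = (\<Sum>j<n. col j)"
  have tot_row: "(\<Sum>k<m. row k) = tot"
    unfolding tot_def col_def row_def by (rule sum.swap)
  have mn: "real m > 0" "real n > 0" "real (m + n) > 0" using m n by auto
  have qq: "qq i j = (R2 i j s - col j) / real m" if "i < m" "j < n" for i j
    using E2[OF that] mn by (simp add: col_def field_simps)
  have tt: "tt k l = (R3 k l s + (if k + m * l < M - 1 then row k else 0)) / real n"
    if "k < m" "l < n" for k l
    using E3[OF that] last[of k l] mn by (auto simp: row_def R3_def field_simps)
  have sum_qq: "(\<Sum>i<m. qq i j) = a2 j s - col j" if "j < n" for j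
  proof -
    have "(\<Sum>i<m. qq i j) = (\<Sum>i<m. (R2 i j s - col j) / real m)"
      using that by (intro sum.cong refl) (simp add: qq)
    also have "\<dots> = ((\<Sum>i<m. R2 i j s) - real m * col j) / real m"
      by (simp add: sum_divide_distrib[symmetric] sum_subtractf)
    finally show ?thesis using mn by (simp add: a2_def diff_divide_distrib)
  qed
  have sum_tt: "(\<Sum>l<n. tt k l) = a3 k s + row k - (if k = m - 1 then row k / real n else 0)"
    if "k < m" for k
  proof -
    have "(\<Sum>l<n. tt k l) = (\<Sum>l<n. (R3 k l s
        + (row k - (if l = n - 1 then if k = m - 1 then row k else 0 else 0))) / real n)"
    proof (intro sum.cong refl)
      fix l assume "l \<in> {..<n}"
      then have l: "l < n" by simp
      show "tt k l = (R3 k l s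
          + (row k - (if l = n - 1 then if k = m - 1 then row k else 0 else 0))) / real n"
        unfolding tt[OF that l] not_last_iff[OF that l] by auto
    qed
    also have "\<dots> = ((\<Sum>l<n. R3 k l s) + (real n * row k - (if k = m - 1 then row k else 0))) / real n"
      using n by (simp add: sum_divide_distrib[symmetric] sum.distrib sum_subtractf)
    finally show ?thesis using mn by (simp add: a3_def add_divide_distrib diff_divide_distrib)
  qed
  \<comment> \<open>The only row sum affected by the omitted constraint; it stays an unknown until
    the row equations determine it.\<close>
  define S where "S = row (m - 1)"
  have pp: "real (m + n) * pp k j = W k j s + col j + row k - (if k = m - 1 then S / real n else 0)"
    if "k < m" "j < n" for k j
    using E1[OF that] sum_qq[OF that(2)] sum_tt[OF that(1)] by (auto simp: W_def S_def)
  have col: "real n * col j = Wcol j s + tot - S / real n" if "j < n" for j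
  proof -
    have "real (m + n) * col j = (\<Sum>k<m. real (m + n) * pp k j)"
      by (simp only: col_def sum_distrib_left)
    also have "\<dots> = (\<Sum>k<m. W k j s + col j + row k - (if k = m - 1 then S / real n else 0))"
      using that by (intro sum.cong refl pp) auto
    also have "\<dots> = Wcol j s + real m * col j + tot - S / real n"
      using m by (simp add: sum.distrib sum_subtractf Wcol_def tot_row)
    finally show ?thesis by (simp add: algebra_simps)
  qed
  have row: "real m * row k = Wrow k s + tot - (if k = m - 1 then S else 0)" if "k < m" for k
  proof -
    have "real (m + n) * row k = (\<Sum>j<n. real (m + n) * pp k j)"
      by (simp only: row_def sum_distrib_left)
    also have "\<dots> = (\<Sum>j<n. W k j s + col j + row k - (if k = m - 1 then S / real n else 0))"
      using that by (intro sum.cong refl pp) auto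
    also have "\<dots> = Wrow k s + tot + real n * row k - (if k = m - 1 then S else 0)"
      using mn by (simp add: sum.distrib sum_subtractf Wrow_def tot_def)
    finally show ?thesis by (simp add: algebra_simps)
  qed
  \<comment> \<open>Summing the row equations over k cancels m * tot and leaves S alone. The term S
    comes from the omitted constraint; it is what also fixes the total in the next step.\<close>
  have S: "S = Wtot s"
  proof -
    have "real m * tot = (\<Sum>k<m. Wrow k s + tot - (if k = m - 1 then S else 0))"
      unfolding tot_row[symmetric] sum_distrib_left
      by (intro sum.cong refl) (simp add: row tot_row)
    also have "\<dots> = Wtot s + real m * tot - S"
      using m by (simp add: sum.distrib sum_subtractf Wtot_def)
    finally show ?thesis by simp
  qed
  have tot: "tot = ptot s"
  proof -
    have "real m * S = Wrow (m - 1) s + tot - S"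
      using row[of "m - 1"] m unfolding S_def by simp
    then show ?thesis by (simp add: ptot_def S[symmetric] algebra_simps)
  qed
  have col': "col j = pcol j s" if "j < n" for j
    using col[OF that] mn unfolding pcol_def S tot by (simp only: eq_divide_eq) (simp add: mult.commute)
  have row': "row k = prow k s" if "k < m" for k
    using row[OF that] mn unfolding prow_def S tot by (simp only: eq_divide_eq) (simp add: mult.commute)
  show "k < m \<Longrightarrow> j < n \<Longrightarrow> pp k j = p k j s"
    using pp[of k j] mn col'[of j] row'[of k] by (simp add: p_def S eq_divide_eq mult.commute)
  show "i < m \<Longrightarrow> j < n \<Longrightarrow> qq i j = q i j s"
    using qq[of i j] col'[of j] by (simp add: q_def)
  show "k < m \<Longrightarrow> l < n \<Longrightarrow> tt k l = t k l s"
    using tt[of k l] row'[of k] last[of k l] by (auto simp: t_def)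
qed

lemma normal_equations_solution:
  fixes pp qq tt :: "nat \<Rightarrow> nat \<Rightarrow> real"
  assumes sg: "sg s \<noteq> 0"
    and x1: "\<And>i k j. i < m \<Longrightarrow> k < m \<Longrightarrow> j < n \<Longrightarrow>
      xx (fl1 i k j) = w (fl1 i k j) s + sg s * (pp k j + qq i j)"
    and x2: "\<And>k j l. k < m \<Longrightarrow> j < n \<Longrightarrow> l < n \<Longrightarrow>
      xx (fl2 k j l) = w (fl2 k j l) s + sg s * (tt k l - pp k j)"
    and r1: "\<And>k j. k < m \<Longrightarrow> j < n \<Longrightarrow> (\<Sum>i<m. xx (fl1 i k j)) - (\<Sum>l<n. xx (fl2 k j l)) = 0"
    and r2: "\<And>i j. i < m \<Longrightarrow> j < n \<Longrightarrow> (\<Sum>k<m. xx (fl1 i k j)) = mu1 (i + m * j) s"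
    and r3: "\<And>k l. k < m \<Longrightarrow> l < n \<Longrightarrow> k + m * l < M - 1 \<Longrightarrow>
      (\<Sum>j<n. xx (fl2 k j l)) = mu2 (k + m * l) s"
    and last: "\<And>k l. \<not> k + m * l < M - 1 \<Longrightarrow> tt k l = 0"
  shows "k < m \<Longrightarrow> j < n \<Longrightarrow> pp k j = p k j s"
    and "i < m \<Longrightarrow> j < n \<Longrightarrow> qq i j = q i j s"
    and "k < m \<Longrightarrow> l < n \<Longrightarrow> tt k l = t k l s"
proof -
  have E1: "real (m + n) * pp k j + (\<Sum>i<m. qq i j) - (\<Sum>l<n. tt k l) = R1 k j s"
    if "k < m" "j < n" for k j
  proof -
    have "(\<Sum>i<m. xx (fl1 i k j)) = (\<Sum>i<m. w (fl1 i k j) s) + sg s * (real m * pp k j + (\<Sum>i<m. qq i j))"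
      using that by (simp add: x1 sum.distrib sum_distrib_left[symmetric])
    moreover have "(\<Sum>l<n. xx (fl2 k j l)) = (\<Sum>l<n. w (fl2 k j l) s) + sg s * ((\<Sum>l<n. tt k l) - real n * pp k j)"
      using that by (simp add: x2 sum.distrib sum_subtractf sum_distrib_left[symmetric])
    ultimately show ?thesis
      using r1[OF that] sg by (simp add: R1_def eq_divide_eq) (simp add: algebra_simps)
  qed
  have E2: "real m * qq i j + (\<Sum>k<m. pp k j) = R2 i j s" if "i < m" "j < n" for i j
  proof -
    have "(\<Sum>k<m. xx (fl1 i k j)) = (\<Sum>k<m. w (fl1 i k j) s) + sg s * ((\<Sum>k<m. pp k j) + real m * qq i j)"
      using that by (simp add: x1 sum.distrib sum_distrib_left[symmetric])
    then show ?thesis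
      using r2[OF that] sg by (simp add: R2_def eq_divide_eq)
  qed
  have E3: "real n * tt k l - (\<Sum>j<n. pp k j) = R3 k l s"
    if "k < m" "l < n" "k + m * l < M - 1" for k l
  proof -
    have "(\<Sum>j<n. xx (fl2 k j l)) = (\<Sum>j<n. w (fl2 k j l) s) + sg s * (real n * tt k l - (\<Sum>j<n. pp k j))"
      using that by (simp add: x2 sum.distrib sum_subtractf sum_distrib_left[symmetric])
    then show ?thesis
      using r3[OF that] sg that(3) by (simp add: R3_def eq_divide_eq)
  qed
  show "k < m \<Longrightarrow> j < n \<Longrightarrow> pp k j = p k j s"
    and "i < m \<Longrightarrow> j < n \<Longrightarrow> qq i j = q i j s"
    and "k < m \<Longrightarrow> l < n \<Longrightarrow> tt k l = t k l s"
    using normal_equations_unique[of pp qq tt s, OF E1 E2 E3 last] by blast+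
qed

end

lemma evaluates_le: "evaluates S a f \<Longrightarrow> a \<le> b \<Longrightarrow> evaluates S b f"
  by (rule slp_le_mono) auto

text \<open>The rules follow the syntax of an expression, so applying them repeatedly produces its
  cost; \<open>evaluates_le\<close> compares the result with the budget.\<close>

lemmas evaluates_rules = evaluates_real evaluates_0 evaluates_1 evaluates_numeral evaluates_plus
  evaluates_minus evaluates_times evaluates_divide evaluates_max evaluates_power2 evaluates_sum
  evaluates_if

section \<open>Cost of one pass\<close>

context hot_pass
begin

definition aty :: "nat \<Rightarrow> 's \<Rightarrow> real" where
  "aty i s = (if i < m^2 * n
     then p (i div m mod m) (i div m div m) s + q (i mod m) (i div m div m) s
     else t ((i - m^2 * n) mod m) ((i - m^2 * n) div M) s
       - p ((i - m^2 * n) mod m) ((i - m^2 * n) mod M div m) s)"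

definition xb :: "nat \<Rightarrow> 's \<Rightarrow> real" where
  "xb i s = w i s + sg s * aty i s"

definition zb :: "nat \<Rightarrow> 's \<Rightarrow> real" where
  "zb i s = max 0 ((u i s - 2 * xb i s) / sg s)"

definition ub :: "nat \<Rightarrow> 's \<Rightarrow> real" where
  "ub i s = xb i s + sg s * zb i s"

definition yb :: "nat \<Rightarrow> 's \<Rightarrow> real" where
  "yb r s = (if r < M then p (r mod m) (r div m) s
     else if r < 2 * M then q ((r - M) mod m) ((r - M) div m) s
     else t ((r - 2 * M) mod m) ((r - 2 * M) div m) s)"

definition gapsq :: "'s \<Rightarrow> real" where
  "gapsq s = (\<Sum>i<N. (u i s - ub i s)\<^sup>2)"

lemma N_eq: "N = m * n * (m + n)"
  by (simp add: dimN_def power2_eq_square algebra_simps)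

lemma fl_less_N:
  "i < m \<Longrightarrow> k < m \<Longrightarrow> j < n \<Longrightarrow> fl1 i k j < N"
  "k < m \<Longrightarrow> j < n \<Longrightarrow> l < n \<Longrightarrow> fl2 k j l < N"
  using flow1_less[OF m n] flow2_less[OF m n] by (auto simp: dimN_def intro: trans_less_add1)

lemma M_digits: "r < M \<Longrightarrow> r mod m < m" "r < M \<Longrightarrow> r div m < n"
  using m by (auto simp: dimM_def less_mult_imp_div_less mult.commute)

text \<open>As N = m n (m + n), a family of at most m n values may spend a multiple of m + n
  instructions on each, enough for one sum along a grid direction.\<close>

lemma stage_cost:
  assumes "c \<le> m * n" "a \<le> 10 * (m + n)"
  shows "c * a \<le> 10 * N"
  using mult_le_mono[OF assms] by (simp add: N_eq algebra_simps)

lemma pass_stage: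
  assumes "slp_le S L T" "finite I" "\<And>i. i \<in> I \<Longrightarrow> evaluates T a (f i)" "card I * a \<le> 10 * N"
  shows "slp_le S (L + 10 * N) (T \<union> f ` I)"
  by (rule slp_le_mono[OF slp_le_stage[OF assms(1-3)]]) (use assms(4) in auto)

lemma pass_stage_pairs:
  assumes "slp_le S L T" "L + 10 * N \<le> L'" "a \<le> 10 * (m + n)" "A * B \<le> m * n"
    and f: "\<And>i j. i < A \<Longrightarrow> j < B \<Longrightarrow> evaluates T a (f i j)"
  obtains T' where "slp_le S L' T'" "T \<subseteq> T'" "\<And>i j. i < A \<Longrightarrow> j < B \<Longrightarrow> f i j \<in> T'"
proof -
  let ?I = "{..<A} \<times> {..<B}"
  have "slp_le S (L + 10 * N) (T \<union> (\<lambda>(i, j). f i j) ` ?I)"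
    using f stage_cost[OF assms(4,3)] by (intro pass_stage[OF assms(1)]) auto
  then have "slp_le S L' (T \<union> (\<lambda>(i, j). f i j) ` ?I)"
    by (rule slp_le_mono) (use assms(2) in auto)
  then show thesis by (rule that) auto
qed

lemma pass_stage_single:
  assumes "slp_le S L T" "L + 10 * N \<le> L'" "A * a \<le> 10 * N"
    and f: "\<And>i. i < A \<Longrightarrow> evaluates T a (f i)"
  obtains T' where "slp_le S L' T'" "T \<subseteq> T'" "\<And>i. i < A \<Longrightarrow> f i \<in> T'"
proof -
  have "slp_le S (L + 10 * N) (T \<union> f ` {..<A})"
    using f assms(3) by (intro pass_stage[OF assms(1)]) auto
  then have "slp_le S L' (T \<union> f ` {..<A})"
    by (rule slp_le_mono) (use assms(2) in auto)
  then show thesis by (rule that) auto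
qed

lemma pass_stage_one:
  assumes "slp_le S L T" "L + 10 * N \<le> L'" "a \<le> 10 * N" "evaluates T a f"
  obtains T' where "slp_le S L' T'" "T \<subseteq> T'" "f \<in> T'"
  by (rule pass_stage_single[of S L T L' 1 a "\<lambda>_. f"]) (use assms that in auto)

lemma flow_digits_bound:
  "i < m\<^sup>2 * n \<Longrightarrow> i div m div m < n" "i < m * n\<^sup>2 \<Longrightarrow> i div M < n" "i mod M div m < n"
proof -
  show "i div m div m < n" if "i < m\<^sup>2 * n"
    using that by (intro less_mult_imp_div_less) (simp add: power2_eq_square algebra_simps)
  show "i div M < n" if "i < m * n\<^sup>2"
    using that by (intro less_mult_imp_div_less) (simp add: dimM_def power2_eq_square algebra_simps)
  show "i mod M div m < n"
    using dimM_pos[OF m n] by (intro M_digits) simp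
qed

text \<open>Each of the 22 families of values takes at most \<open>10 N\<close> instructions.\<close>

lemma pass_cost:
  assumes S: "slp_le S L T0" and sg: "sg \<in> T0"
    and mu: "\<And>i. i < M \<Longrightarrow> mu1 i \<in> T0" "\<And>i. i < M \<Longrightarrow> mu2 i \<in> T0"
    and u: "\<And>i. i < N \<Longrightarrow> u i \<in> T0"
  obtains T where "slp_le S (L + 220 * N) T" "T0 \<subseteq> T"
    "\<And>i. i < N \<Longrightarrow> xb i \<in> T" "\<And>i. i < N \<Longrightarrow> zb i \<in> T" "\<And>i. i < N \<Longrightarrow> ub i \<in> T"
    "\<And>r. r < dimM3 m n \<Longrightarrow> yb r \<in> T" "gapsq \<in> T"
proof -
  have mn: "1 \<le> m" "1 \<le> n" "m \<le> m * n" "n \<le> m * n" "1 \<le> m * n" using m n by auto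
  have N: "2 * (m * n) \<le> N" "m + n \<le> N"
  proof -
    have "m * n * 2 \<le> m * n * (m + n)" using mn by (intro mult_le_mono2) linarith
    then show "2 * (m * n) \<le> N" by (simp add: N_eq)
    have "1 * (m + n) \<le> m * n * (m + n)" using mn by (intro mult_le_mono1)
    then show "m + n \<le> N" by (simp add: N_eq)
  qed
  have card_m: "m * (10 * (m + n)) \<le> 10 * N" and card_n: "n * (10 * (m + n)) \<le> 10 * N"
    using mn by (auto intro: stage_cost)
  have M: "i + m * j < M" if "i < m" "j < n" for i j
    using that by (simp add: dimM_def mixed_radix_less)
  note mem0 = sg mu u
  note T0 = S
  have ev: "evaluates T0 10 (w i)" if "i < N" for i
  proof -
    obtain a where a: "vecc m n $ i = real a" using vecc_nat[OF \<open>i < N\<close>] by blast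
    show ?thesis unfolding w_def[abs_def] a
      by (rule evaluates_le,
          (rule evaluates_rules | (rule evaluates_mem, rule mem0; simp add: that))+) simp
  qed
  obtain T1 where T1: "slp_le S (L + 10 * N) T1" "T0 \<subseteq> T1"
    "\<And>i. i < N \<Longrightarrow> w i \<in> T1"
    by (rule pass_stage_single[where L' = "L + 10 * N", OF T0 _ _ ev]) auto
  note mem1 = mem0[THEN subsetD[OF T1(2)]] T1(3)
  have ev: "evaluates T1 (10 * (m + n)) (R1 k j)" if "k < m" "j < n" for k j
    unfolding R1_def[abs_def]
    by (rule evaluates_le,
        (rule evaluates_rules | (rule evaluates_mem, rule mem1; simp add: that fl_less_N M m))+)
      (use mn in simp)
  obtain T2 where T2: "slp_le S (L + 20 * N) T2" "T1 \<subseteq> T2"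
    "\<And>k j. k < m \<Longrightarrow> j < n \<Longrightarrow> R1 k j \<in> T2"
    by (rule pass_stage_pairs[where L' = "L + 20 * N", OF T1(1) _ order_refl order_refl ev]) auto
  note mem2 = mem1[THEN subsetD[OF T2(2)]] T2(3)
  have ev: "evaluates T2 (10 * (m + n)) (R2 i j)" if "i < m" "j < n" for i j
    unfolding R2_def[abs_def]
    by (rule evaluates_le,
        (rule evaluates_rules | (rule evaluates_mem, rule mem2; simp add: that fl_less_N M m))+)
      (use mn in simp)
  obtain T3 where T3: "slp_le S (L + 30 * N) T3" "T2 \<subseteq> T3"
    "\<And>i j. i < m \<Longrightarrow> j < n \<Longrightarrow> R2 i j \<in> T3"
    by (rule pass_stage_pairs[where L' = "L + 30 * N", OF T2(1) _ order_refl order_refl ev]) auto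
  note mem3 = mem2[THEN subsetD[OF T3(2)]] T3(3)
  have ev: "evaluates T3 (10 * (m + n)) (R3 k l)" if "k < m" "l < n" for k l
    unfolding R3_def[abs_def]
    by (rule evaluates_le,
        (rule evaluates_rules | (rule evaluates_mem, rule mem3; simp add: that fl_less_N M m))+)
      (use mn in simp)
  obtain T4 where T4: "slp_le S (L + 40 * N) T4" "T3 \<subseteq> T4"
    "\<And>k l. k < m \<Longrightarrow> l < n \<Longrightarrow> R3 k l \<in> T4"
    by (rule pass_stage_pairs[where L' = "L + 40 * N", OF T3(1) _ order_refl order_refl ev]) auto
  note mem4 = mem3[THEN subsetD[OF T4(2)]] T4(3)
  have ev: "evaluates T4 (10 * (m + n)) (a2 j)" if "j < n" for j
    unfolding a2_def[abs_def]
    by (rule evaluates_le,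
        (rule evaluates_rules | (rule evaluates_mem, rule mem4; simp add: that fl_less_N M m))+)
      (use mn in simp)
  obtain T5 where T5: "slp_le S (L + 50 * N) T5" "T4 \<subseteq> T5"
    "\<And>j. j < n \<Longrightarrow> a2 j \<in> T5"
    by (rule pass_stage_single[where L' = "L + 50 * N", OF T4(1) _ card_n ev]) auto
  note mem5 = mem4[THEN subsetD[OF T5(2)]] T5(3)
  have ev: "evaluates T5 (10 * (m + n)) (a3 k)" if "k < m" for k
    unfolding a3_def[abs_def]
    by (rule evaluates_le,
        (rule evaluates_rules | (rule evaluates_mem, rule mem5; simp add: that fl_less_N M m))+)
      (use mn in simp)
  obtain T6 where T6: "slp_le S (L + 60 * N) T6" "T5 \<subseteq> T6"
    "\<And>k. k < m \<Longrightarrow> a3 k \<in> T6"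
    by (rule pass_stage_single[where L' = "L + 60 * N", OF T5(1) _ card_m ev]) auto
  note mem6 = mem5[THEN subsetD[OF T6(2)]] T6(3)
  have ev: "evaluates T6 (10 * (m + n)) (W k j)" if "k < m" "j < n" for k j
    unfolding W_def[abs_def]
    by (rule evaluates_le,
        (rule evaluates_rules | (rule evaluates_mem, rule mem6; simp add: that fl_less_N M m))+)
      (use mn in simp)
  obtain T7 where T7: "slp_le S (L + 70 * N) T7" "T6 \<subseteq> T7"
    "\<And>k j. k < m \<Longrightarrow> j < n \<Longrightarrow> W k j \<in> T7"
    by (rule pass_stage_pairs[where L' = "L + 70 * N", OF T6(1) _ order_refl order_refl ev]) auto
  note mem7 = mem6[THEN subsetD[OF T7(2)]] T7(3)
  have ev: "evaluates T7 (10 * (m + n)) (Wcol j)" if "j < n" for j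
    unfolding Wcol_def[abs_def]
    by (rule evaluates_le,
        (rule evaluates_rules | (rule evaluates_mem, rule mem7; simp add: that fl_less_N M m))+)
      (use mn in simp)
  obtain T8 where T8: "slp_le S (L + 80 * N) T8" "T7 \<subseteq> T8"
    "\<And>j. j < n \<Longrightarrow> Wcol j \<in> T8"
    by (rule pass_stage_single[where L' = "L + 80 * N", OF T7(1) _ card_n ev]) auto
  note mem8 = mem7[THEN subsetD[OF T8(2)]] T8(3)
  have ev: "evaluates T8 (10 * (m + n)) (Wrow k)" if "k < m" for k
    unfolding Wrow_def[abs_def]
    by (rule evaluates_le,
        (rule evaluates_rules | (rule evaluates_mem, rule mem8; simp add: that fl_less_N M m))+)
      (use mn in simp)
  obtain T9 where T9: "slp_le S (L + 90 * N) T9" "T8 \<subseteq> T9"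
    "\<And>k. k < m \<Longrightarrow> Wrow k \<in> T9"
    by (rule pass_stage_single[where L' = "L + 90 * N", OF T8(1) _ card_m ev]) auto
  note mem9 = mem8[THEN subsetD[OF T9(2)]] T9(3)
  have ev: "evaluates T9 (10 * N) Wtot"
    unfolding Wtot_def[abs_def]
    by (rule evaluates_le,
        (rule evaluates_rules | (rule evaluates_mem, rule mem9; simp add: fl_less_N M m))+)
      (use mn N in simp)
  obtain T10 where T10: "slp_le S (L + 100 * N) T10" "T9 \<subseteq> T10" "Wtot \<in> T10"
    by (rule pass_stage_one[where L' = "L + 100 * N", OF T9(1) _ order_refl ev]) auto
  note mem10 = mem9[THEN subsetD[OF T10(2)]] T10(3)
  have ev: "evaluates T10 (10 * N) ptot"
    unfolding ptot_def[abs_def]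
    by (rule evaluates_le,
        (rule evaluates_rules | (rule evaluates_mem, rule mem10; simp add: fl_less_N M m))+)
      (use mn N in simp)
  obtain T11 where T11: "slp_le S (L + 110 * N) T11" "T10 \<subseteq> T11" "ptot \<in> T11"
    by (rule pass_stage_one[where L' = "L + 110 * N", OF T10(1) _ order_refl ev]) auto
  note mem11 = mem10[THEN subsetD[OF T11(2)]] T11(3)
  have ev: "evaluates T11 (10 * (m + n)) (pcol j)" if "j < n" for j
    unfolding pcol_def[abs_def]
    by (rule evaluates_le,
        (rule evaluates_rules | (rule evaluates_mem, rule mem11; simp add: that fl_less_N M m))+)
      (use mn in simp)
  obtain T12 where T12: "slp_le S (L + 120 * N) T12" "T11 \<subseteq> T12"
    "\<And>j. j < n \<Longrightarrow> pcol j \<in> T12"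
    by (rule pass_stage_single[where L' = "L + 120 * N", OF T11(1) _ card_n ev]) auto
  note mem12 = mem11[THEN subsetD[OF T12(2)]] T12(3)
  have ev: "evaluates T12 (10 * (m + n)) (prow k)" if "k < m" for k
    unfolding prow_def[abs_def]
    by (rule evaluates_le,
        (rule evaluates_rules | (rule evaluates_mem, rule mem12; simp add: that fl_less_N M m))+)
      (use mn in simp)
  obtain T13 where T13: "slp_le S (L + 130 * N) T13" "T12 \<subseteq> T13"
    "\<And>k. k < m \<Longrightarrow> prow k \<in> T13"
    by (rule pass_stage_single[where L' = "L + 130 * N", OF T12(1) _ card_m ev]) auto
  note mem13 = mem12[THEN subsetD[OF T13(2)]] T13(3)
  have ev: "evaluates T13 (10 * (m + n)) (p k j)" if "k < m" "j < n" for k j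
    unfolding p_def[abs_def]
    by (rule evaluates_le,
        (rule evaluates_rules | (rule evaluates_mem, rule mem13; simp add: that fl_less_N M m))+)
      (use mn in simp)
  obtain T14 where T14: "slp_le S (L + 140 * N) T14" "T13 \<subseteq> T14"
    "\<And>k j. k < m \<Longrightarrow> j < n \<Longrightarrow> p k j \<in> T14"
    by (rule pass_stage_pairs[where L' = "L + 140 * N", OF T13(1) _ order_refl order_refl ev]) auto
  note mem14 = mem13[THEN subsetD[OF T14(2)]] T14(3)
  have ev: "evaluates T14 (10 * (m + n)) (q i j)" if "i < m" "j < n" for i j
    unfolding q_def[abs_def]
    by (rule evaluates_le,
        (rule evaluates_rules | (rule evaluates_mem, rule mem14; simp add: that fl_less_N M m))+)
      (use mn in simp)
  obtain T15 where T15: "slp_le S (L + 150 * N) T15" "T14 \<subseteq> T15"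
    "\<And>i j. i < m \<Longrightarrow> j < n \<Longrightarrow> q i j \<in> T15"
    by (rule pass_stage_pairs[where L' = "L + 150 * N", OF T14(1) _ order_refl order_refl ev]) auto
  note mem15 = mem14[THEN subsetD[OF T15(2)]] T15(3)
  have ev: "evaluates T15 (10 * (m + n)) (t k l)" if "k < m" "l < n" for k l
    unfolding t_def[abs_def]
    by (rule evaluates_le,
        (rule evaluates_rules | (rule evaluates_mem, rule mem15; simp add: that fl_less_N M m))+)
      (use mn in simp)
  obtain T16 where T16: "slp_le S (L + 160 * N) T16" "T15 \<subseteq> T16"
    "\<And>k l. k < m \<Longrightarrow> l < n \<Longrightarrow> t k l \<in> T16"
    by (rule pass_stage_pairs[where L' = "L + 160 * N", OF T15(1) _ order_refl order_refl ev]) auto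
  note mem16 = mem15[THEN subsetD[OF T16(2)]] T16(3)
  have ev: "evaluates T16 10 (aty i)" if "i < N" for i
  proof (cases "i < m\<^sup>2 * n")
    case True
    then have "aty i = (\<lambda>s. p (i div m mod m) (i div m div m) s + q (i mod m) (i div m div m) s)"
      by (simp add: aty_def fun_eq_iff)
    moreover have "evaluates T16 10 \<dots>"
      by (rule evaluates_le, (rule evaluates_rules
          | (rule evaluates_mem, rule mem16; simp add: m flow_digits_bound True))+) simp
    ultimately show ?thesis by simp
  next
    case False
    then have i: "i - m\<^sup>2 * n < m * n\<^sup>2" using that by (simp add: dimN_def)
    have "aty i = (\<lambda>s. t ((i - m\<^sup>2 * n) mod m) ((i - m\<^sup>2 * n) div M) s
       - p ((i - m\<^sup>2 * n) mod m) ((i - m\<^sup>2 * n) mod M div m) s)"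
      using False by (simp add: aty_def fun_eq_iff)
    moreover have "evaluates T16 10 \<dots>"
      by (rule evaluates_le, (rule evaluates_rules
          | (rule evaluates_mem, rule mem16; simp add: m flow_digits_bound i))+) simp
    ultimately show ?thesis by simp
  qed
  obtain T17 where T17: "slp_le S (L + 170 * N) T17" "T16 \<subseteq> T17"
    "\<And>i. i < N \<Longrightarrow> aty i \<in> T17"
    by (rule pass_stage_single[where L' = "L + 170 * N", OF T16(1) _ _ ev]) auto
  note mem17 = mem16[THEN subsetD[OF T17(2)]] T17(3)
  have ev: "evaluates T17 10 (xb i)" if "i < N" for i
    unfolding xb_def[abs_def]
    by (rule evaluates_le,
        (rule evaluates_rules | (rule evaluates_mem, rule mem17; simp add: that fl_less_N M m))+)
      (use mn in simp)
  obtain T18 where T18: "slp_le S (L + 180 * N) T18" "T17 \<subseteq> T18"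
    "\<And>i. i < N \<Longrightarrow> xb i \<in> T18"
    by (rule pass_stage_single[where L' = "L + 180 * N", OF T17(1) _ _ ev]) auto
  note mem18 = mem17[THEN subsetD[OF T18(2)]] T18(3)
  have ev: "evaluates T18 10 (zb i)" if "i < N" for i
    unfolding zb_def[abs_def]
    by (rule evaluates_le,
        (rule evaluates_rules | (rule evaluates_mem, rule mem18; simp add: that fl_less_N M m))+)
      (use mn in simp)
  obtain T19 where T19: "slp_le S (L + 190 * N) T19" "T18 \<subseteq> T19"
    "\<And>i. i < N \<Longrightarrow> zb i \<in> T19"
    by (rule pass_stage_single[where L' = "L + 190 * N", OF T18(1) _ _ ev]) auto
  note mem19 = mem18[THEN subsetD[OF T19(2)]] T19(3)
  have ev: "evaluates T19 10 (ub i)" if "i < N" for i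
    unfolding ub_def[abs_def]
    by (rule evaluates_le,
        (rule evaluates_rules | (rule evaluates_mem, rule mem19; simp add: that fl_less_N M m))+)
      (use mn in simp)
  obtain T20 where T20: "slp_le S (L + 200 * N) T20" "T19 \<subseteq> T20"
    "\<And>i. i < N \<Longrightarrow> ub i \<in> T20"
    by (rule pass_stage_single[where L' = "L + 200 * N", OF T19(1) _ _ ev]) auto
  note mem20 = mem19[THEN subsetD[OF T20(2)]] T20(3)
  \<comment> \<open>The budget is 0: every component of y is a value of \<open>p\<close>,
    \<open>q\<close> or \<open>t\<close> that is already available.\<close>
  have ev: "evaluates T20 0 (yb r)" if "r < dimM3 m n" for r
  proof -
    consider "r < M" | "\<not> r < M" "r - M < M" "r < 2 * M"
      | "\<not> r < M" "r - 2 * M < M" "\<not> r < 2 * M"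
      using \<open>r < dimM3 m n\<close> unfolding dimM3_def by linarith
    then have "yb r \<in> T20"
    proof cases
      case 1
      then have "yb r = p (r mod m) (r div m)" by (simp add: yb_def fun_eq_iff)
      then show ?thesis using mem20 M_digits[OF 1] by simp
    next
      case 2
      then have "yb r = q ((r - M) mod m) ((r - M) div m)" by (simp add: yb_def fun_eq_iff)
      then show ?thesis using mem20 M_digits[OF 2(2)] by simp
    next
      case 3
      then have "yb r = t ((r - 2 * M) mod m) ((r - 2 * M) div m)"
        by (simp add: yb_def fun_eq_iff)
      then show ?thesis using mem20 M_digits[OF 3(2)] by simp
    qed
    then show ?thesis by (rule evaluates_mem)
  qed
  obtain T21 where T21: "slp_le S (L + 210 * N) T21" "T20 \<subseteq> T21"
    "\<And>r. r < dimM3 m n \<Longrightarrow> yb r \<in> T21"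
    by (rule pass_stage_single[where L' = "L + 210 * N", OF T20(1) _ _ ev]) auto
  note mem21 = mem20[THEN subsetD[OF T21(2)]] T21(3)
  have ev: "evaluates T21 (10 * N) gapsq"
    unfolding gapsq_def[abs_def]
    by (rule evaluates_le,
        (rule evaluates_rules | (rule evaluates_mem, rule mem21; simp add: fl_less_N M m))+)
      (use mn N in simp)
  obtain T22 where T22: "slp_le S (L + 220 * N) T22" "T21 \<subseteq> T22" "gapsq \<in> T22"
    by (rule pass_stage_one[where L' = "L + 220 * N", OF T21(1) _ order_refl ev]) auto
  note mem22 = mem21[THEN subsetD[OF T22(2)]] T22(3)
  show thesis
  proof (rule that[OF T22(1)])
    show "T0 \<subseteq> T22"
      using T1(2) T2(2) T3(2) T4(2) T5(2) T6(2) T7(2) T8(2) T9(2) T10(2) T11(2) T12(2) T13(2) T14(2) T15(2) T16(2) T17(2) T18(2) T19(2) T20(2) T21(2) T22(2) by order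
  qed (use mem22 in auto)
qed

end

section \<open>Agreement of a computed pass with the run\<close>

lemma vecb_index:
  assumes "0 < m" "0 < n" "\<mu>1 \<in> carrier_vec (dimM m n)" "\<mu>2 \<in> carrier_vec (dimM m n)"
  shows "r < dimM m n \<Longrightarrow> vecb m n \<mu>1 \<mu>2 $ r = 0"
    and "r < dimM m n \<Longrightarrow> vecb m n \<mu>1 \<mu>2 $ (dimM m n + r) = \<mu>1 $ r"
    and "r < dimM m n - 1 \<Longrightarrow> vecb m n \<mu>1 \<mu>2 $ (2 * dimM m n + r) = \<mu>2 $ r"
proof -
  have "(Ibar (dimM m n) *\<^sub>v \<mu>2) $ r = \<mu>2 $ r" if r: "r < dimM m n - 1"
  proof -
    have "(Ibar (dimM m n) *\<^sub>v \<mu>2) $ r = (\<Sum>j<dimM m n. of_bool (j = r) * \<mu>2 $ j)"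
      using r assms dimM_pos[OF assms(1,2)]
      by (auto simp: scalar_prod_sum[OF assms(4)] intro!: sum.cong)
    then show ?thesis using r by (simp add: sum_of_bool_eq)
  qed
  then show "r < dimM m n \<Longrightarrow> vecb m n \<mu>1 \<mu>2 $ r = 0"
    "r < dimM m n \<Longrightarrow> vecb m n \<mu>1 \<mu>2 $ (dimM m n + r) = \<mu>1 $ r"
    "r < dimM m n - 1 \<Longrightarrow> vecb m n \<mu>1 \<mu>2 $ (2 * dimM m n + r) = \<mu>2 $ r"
    using assms by (auto simp: vecb_def simp del: index_mult_mat_vec)
qed

text \<open>Feasibility of \<open>xbar\<close> makes the blocks of \<open>ybar\<close> solve the
  normal equations, so they are the computed \<open>p\<close>, \<open>q\<close>, \<open>t\<close>.
  The remaining values follow from the coordinate formulas, in which x^k and z^k enter only through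
  U.\<close>

lemma (in hot_pass) pass_correct:
  assumes hot: "hot m n \<mu>1 \<mu>2 \<sigma> y z x ybar zbar xbar xstar zstar"
    and sg: "sg s = \<sigma>" and mu1: "\<And>i. i < M \<Longrightarrow> mu1 i s = \<mu>1 $ i"
    and mu2: "\<And>i. i < M \<Longrightarrow> mu2 i s = \<mu>2 $ i"
    and u: "\<And>i. i < N \<Longrightarrow> u i s = hot.U \<sigma> z x \<kappa> i"
  shows "i < N \<Longrightarrow> xb i s = xbar \<kappa> $ i" and "i < N \<Longrightarrow> zb i s = zbar \<kappa> $ i"
    and "i < N \<Longrightarrow> ub i s = hot.Ubar \<sigma> zbar xbar \<kappa> i"
    and "r < dimM3 m n \<Longrightarrow> yb r s = ybar \<kappa> $ r"
    and "gapsq s = (L2_set (\<lambda>i. hot.U \<sigma> z x \<kappa> i - hot.Ubar \<sigma> zbar xbar \<kappa> i) {..<N})\<^sup>2"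
proof -
  interpret H: hot m n \<mu>1 \<mu>2 \<sigma> y z x ybar zbar xbar xstar zstar by (rule hot)
  define pp where "pp k j = ybar \<kappa> $ (k + m * j)" for k j
  define qq where "qq i j = ybar \<kappa> $ (M + (i + m * j))" for i j
  define tt where "tt k l = (if k + m * l < M - 1 then ybar \<kappa> $ (2 * M + (k + m * l)) else 0)" for k l
  note bidx = vecb_index[OF m n H.mu_carrier]
  note xc = H.limit_carrier(3)[of \<kappa>]
  have M: "i + m * j < M" if "i < m" "j < n" for i j
    using that by (simp add: dimM_def mixed_radix_less)
  have AT1: "H.AT \<kappa> $ fl1 i k j = pp k j + qq i j" if "i < m" "k < m" "j < n" for i k j
    unfolding H.AT_def pp_def qq_def by (rule transpose_matA_flow1[OF m n H.ybar_carrier that])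
  have AT2: "H.AT \<kappa> $ fl2 k j l = tt k l - pp k j" if "k < m" "j < n" "l < n" for k j l
    unfolding H.AT_def pp_def tt_def using transpose_matA_flow2[OF m n H.ybar_carrier that] by simp
  have xbar: "xbar \<kappa> $ i = w i s + sg s * H.AT \<kappa> $ i" if "i < N" for i
    using H.xbar_index[OF that] u[OF that] by (simp add: w_def sg algebra_simps)
  have sg0: "sg s \<noteq> 0" using sg H.sigma by simp
  have x1: "xbar \<kappa> $ fl1 i k j = w (fl1 i k j) s + sg s * (pp k j + qq i j)"
    if "i < m" "k < m" "j < n" for i k j
    using xbar[OF fl_less_N(1)[OF that]] AT1[OF that] by simp
  have x2: "xbar \<kappa> $ fl2 k j l = w (fl2 k j l) s + sg s * (tt k l - pp k j)"
    if "k < m" "j < n" "l < n" for k j l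
    using xbar[OF fl_less_N(2)[OF that]] AT2[OF that] by simp
  have r1: "(\<Sum>i<m. xbar \<kappa> $ fl1 i k j) - (\<Sum>l<n. xbar \<kappa> $ fl2 k j l) = 0"
    if "k < m" "j < n" for k j
    using matA_row1[OF m n xc that] bidx(1)[OF M[OF that]] unfolding H.primal_feasible by simp
  have r2: "(\<Sum>k<m. xbar \<kappa> $ fl1 i k j) = mu1 (i + m * j) s" if "i < m" "j < n" for i j
    using matA_row2[OF m n xc that] bidx(2)[OF M[OF that]] mu1[OF M[OF that]]
    unfolding H.primal_feasible by simp
  have r3: "(\<Sum>j<n. xbar \<kappa> $ fl2 k j l) = mu2 (k + m * l) s"
    if "k < m" "l < n" "k + m * l < M - 1" for k l
    using matA_row3[OF m n xc that] bidx(3)[OF that(3)] mu2[OF M[OF that(1,2)]]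
    unfolding H.primal_feasible by simp
  have last: "tt k l = 0" if "\<not> k + m * l < M - 1" for k l using that by (simp add: tt_def)
  note solution = normal_equations_solution[of s "\<lambda>i. xbar \<kappa> $ i" pp qq tt,
      OF sg0 x1 x2 r1 r2 r3 last]
  have aty: "aty i s = H.AT \<kappa> $ i" if "i < N" for i
  proof (cases "i < m\<^sup>2 * n")
    case True
    then have "H.AT \<kappa> $ fl1 (i mod m) (i div m mod m) (i div m div m) = aty i s"
      using m flow_digits_bound(1)[OF True] by (subst AT1) (auto simp: solution(1,2) aty_def)
    then show ?thesis by simp
  next
    case False
    define i' where "i' = i - m\<^sup>2 * n"
    have i': "i' < m * n\<^sup>2" "i = m\<^sup>2 * n + i'" using that False by (auto simp: i'_def dimN_def)
    \<comment> \<open>\<open>aty\<close> reads the digits of i' modulo M, \<open>flow2\<close> by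
      successive division; the two readings agree.\<close>
    have j: "i' mod M div m = i' div m mod n" and l: "i' div M = i' div m div n"
      using m by (simp_all add: dimM_def mod_mult2_eq div_mult2_eq)
    have "H.AT \<kappa> $ fl2 (i' mod m) (i' div m mod n) (i' div m div n) = aty i s"
      using m n flow_digits_bound(2)[OF i'(1)] False
      by (subst AT2) (auto simp: solution(1,3) aty_def j l i'_def[symmetric])
    then show ?thesis by (simp add: i'(2))
  qed
  show xb: "xb i s = xbar \<kappa> $ i" if "i < N" for i
    by (simp add: xb_def aty xbar that)
  show zb: "zb i s = zbar \<kappa> $ i" if "i < N" for i
    by (simp add: zb_def xb H.zbar_index u sg that)
  show ub: "ub i s = H.Ubar \<kappa> i" if "i < N" for i
    by (simp add: ub_def xb zb H.Ubar_def sg that)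
  show "gapsq s = (L2_set (\<lambda>i. H.U \<kappa> i - H.Ubar \<kappa> i) {..<N})\<^sup>2"
    unfolding gapsq_def L2_set_sq by (rule sum.cong) (auto simp: u ub)
  show "yb r s = ybar \<kappa> $ r" if r: "r < dimM3 m n"
  proof -
    have digits: "e mod m + m * (e div m) = e" for e by simp
    consider "r < M" | "\<not> r < M" "r - M < M" "r < 2 * M"
      | "\<not> r < M" "r - 2 * M < M - 1" "\<not> r < 2 * M"
      using r unfolding dimM3_def by linarith
    then show ?thesis
    proof cases
      case 1
      then show ?thesis
        using solution(1)[of "r mod m" "r div m"] M_digits[OF 1] by (simp add: yb_def pp_def)
    next
      case 2
      then show ?thesis
        using solution(2)[of "(r - M) mod m" "(r - M) div m"] M_digits[OF 2(2)] by (simp add: yb_def qq_def)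
    next
      case 3
      then have "r - 2 * M < M" by simp
      then show ?thesis
        using solution(3)[of "(r - 2 * M) mod m" "(r - 2 * M) div m"] M_digits[of "r - 2 * M"] 3
        by (simp add: yb_def tt_def)
    qed
  qed
qed

section \<open>The program\<close>

text \<open>Register layout: the input occupies the addresses below \<open>input_len\<close>; then come the
  difference \<open>u\<^sub>k - u\<^sub>0\<close>, the pass counter \<open>k\<close>, the output block and the test register. The difference
  and the counter start at \<open>0\<close>, the default register content, so no initial code is needed.\<close>

locale hot_code =
  fixes m n :: nat
  assumes m_pos: "0 < m" and n_pos: "0 < n"
begin

definition input_len :: nat where
  "input_len = 2 + (dimM m n + (dimM m n + (dimM3 m n + (dimN m n + dimN m n))))"

text \<open>u_k is rebuilt from the input as x^0 + \<sigma> z^0 plus the stored difference u_k -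
  u_0.\<close>

definition cur_u :: "nat \<Rightarrow> (nat \<Rightarrow> real) \<Rightarrow> real" where
  "cur_u i r = r (2 + (dimM m n + (dimM m n + (dimM3 m n + (dimN m n + i)))))
     + r 0 * r (2 + (dimM m n + (dimM m n + (dimM3 m n + i)))) + r (input_len + i)"

definition mu1_reg :: "nat \<Rightarrow> (nat \<Rightarrow> real) \<Rightarrow> real" where
  "mu1_reg i r = r (2 + i)"

definition mu2_reg :: "nat \<Rightarrow> (nat \<Rightarrow> real) \<Rightarrow> real" where
  "mu2_reg i r = r (2 + (dimM m n + i))"

sublocale hot_pass m n "\<lambda>r. r 0" mu1_reg mu2_reg cur_u
  by unfold_locales (rule m_pos n_pos)+

abbreviation "M3 \<equiv> dimM3 m n"

definition out_start :: nat where
  "out_start = input_len + N + 1"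

definition test_addr :: nat where
  "test_addr = out_start + (M3 + (N + N))"

text \<open>The Halpern step for the difference to the anchor: the two weights sum to 1, so u_0
  drops out and only the weight (k + 1) / (k + 2) remains.\<close>

definition next_v :: "nat \<Rightarrow> (nat \<Rightarrow> real) \<Rightarrow> real" where
  "next_v i r = (r (input_len + N) + 1) / (r (input_len + N) + 2)
     * (2 * (ub i r - cur_u i r) + r (input_len + i))"

text \<open>Nonpositive exactly when the squared upper bound on the residual is at most
  \<epsilon>^2; squaring avoids a root.\<close>

definition stop_value :: "(nat \<Rightarrow> real) \<Rightarrow> real" where
  "stop_value r = ((1 + r 0) / r 0)\<^sup>2 * gapsq r - (r 1)\<^sup>2"

definition target :: "nat \<Rightarrow> (nat \<Rightarrow> real) \<Rightarrow> real" where
  "target a =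
     (if a < input_len + N then next_v (a - input_len)
      else if a = input_len + N then (\<lambda>r. r (input_len + N) + 1)
      else if a < out_start + M3 then yb (a - out_start)
      else if a < out_start + (M3 + N) then zb (a - (out_start + M3))
      else if a < test_addr then xb (a - (out_start + (M3 + N)))
      else stop_value)"

lemma body_exists:
  "\<exists>is. length is \<le> 300 * N \<and> (\<forall>r. \<forall>a<input_len. exec is r a = r a) \<and>
    (\<forall>r a. input_len \<le> a \<longrightarrow> a \<le> test_addr \<longrightarrow> exec is r a = target a r)"
proof -
  define S where "S = {\<lambda>r::nat \<Rightarrow> real. r a |a. a < Suc test_addr}"
  have S: "(\<lambda>r. r a) \<in> S" if "a \<le> test_addr" for a
    using that by (auto simp: S_def)
  have addr: "input_len + N < test_addr" "2 + dimM m n + dimM m n + M3 + N + N \<le> test_addr"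
    by (auto simp: test_addr_def out_start_def input_len_def)
  have "evaluates S 10 (cur_u i)" if "i < N" for i
    unfolding cur_u_def[abs_def]
    by (rule evaluates_le, (rule evaluates_rules | (rule evaluates_mem, rule S;
          use addr that in \<open>simp add: input_len_def\<close>))+) simp
  from pass_stage_single[of S 0 S "0 + 10 * N" N 10 cur_u, OF slp_le_refl[OF subset_refl] order_refl _ this]
  obtain T1 where T1: "slp_le S (0 + 10 * N) T1" "S \<subseteq> T1" "\<And>i. i < N \<Longrightarrow> cur_u i \<in> T1"
    by auto
  obtain T2 where T2: "slp_le S (0 + 10 * N + 220 * N) T2" "T1 \<subseteq> T2"
    "\<And>i. i < N \<Longrightarrow> xb i \<in> T2" "\<And>i. i < N \<Longrightarrow> zb i \<in> T2" "\<And>i. i < N \<Longrightarrow> ub i \<in> T2"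
    "\<And>r. r < M3 \<Longrightarrow> yb r \<in> T2" "gapsq \<in> T2"
  proof (rule pass_cost[OF T1(1)])
    show "(\<lambda>r. r 0) \<in> T1" using S[of 0] T1(2) by auto
    show "mu1_reg i \<in> T1" "mu2_reg i \<in> T1" if "i < M" for i
      using that addr S[of "2 + i"] S[of "2 + (dimM m n + i)"] T1(2)
      by (auto simp: mu1_reg_def[abs_def] mu2_reg_def[abs_def])
  qed (use T1(3) in auto)
  have S2: "(\<lambda>r. r a) \<in> T2" if "a \<le> test_addr" for a
    using S[OF that] T1(2) T2(2) by blast
  have cur: "cur_u i \<in> T2" if "i < N" for i using T1(3)[OF that] T2(2) by blast
  have "evaluates T2 10 (next_v i)" if "i < N" for i
    unfolding next_v_def[abs_def]
    by (rule evaluates_le, (rule evaluates_rules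
          | (rule evaluates_mem, rule T2(5) cur S2; use addr that in simp))+) simp
  from pass_stage_single[of S _ T2 "0 + 10 * N + 220 * N + 10 * N" N 10 next_v,
      OF T2(1) order_refl _ this]
  obtain T3 where T3: "slp_le S (0 + 10 * N + 220 * N + 10 * N) T3" "T2 \<subseteq> T3"
    "\<And>i. i < N \<Longrightarrow> next_v i \<in> T3"
    by auto
  have Npos: "1 \<le> N" using m n by (simp add: dimN_def Suc_le_eq)
  have S3: "(\<lambda>r. r a) \<in> T3" if "a \<le> test_addr" for a
    using S2[OF that] T3(2) by blast
  have "evaluates T3 10 stop_value"
    unfolding stop_value_def[abs_def]
    by (rule evaluates_le, (rule evaluates_rules
          | (rule evaluates_mem, rule subsetD[OF T3(2) T2(7)])
          | (rule evaluates_mem, rule S3; use addr in simp))+) simp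
  from pass_stage_one[of S _ T3 "0 + 10 * N + 220 * N + 10 * N + 10 * N" 10 stop_value,
      OF T3(1) order_refl _ this] Npos
  obtain T4 where T4: "slp_le S (0 + 10 * N + 220 * N + 10 * N + 10 * N) T4" "T3 \<subseteq> T4"
    "stop_value \<in> T4"
    by auto
  have "evaluates T4 10 (\<lambda>r. r (input_len + N) + 1)"
    by (rule evaluates_le, (rule evaluates_rules
          | (rule evaluates_mem, rule subsetD[OF T4(2) S3]; use addr in simp))+) simp
  from pass_stage_one[of S _ T4 "0 + 10 * N + 220 * N + 10 * N + 10 * N + 10 * N" 10,
      OF T4(1) order_refl _ this] Npos
  obtain T where T: "slp_le S (0 + 10 * N + 220 * N + 10 * N + 10 * N + 10 * N) T" "T4 \<subseteq> T"
    "(\<lambda>r. r (input_len + N) + 1) \<in> T"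
    by auto
  have T23: "T2 \<subseteq> T" "T3 \<subseteq> T" using T3(2) T4(2) T(2) by auto
  have "target a \<in> T" if "input_len \<le> a" "a < Suc test_addr" for a
    using that T(3) subsetD[OF T(2) T4(3)] subsetD[OF T23(2) T3(3)] subsetD[OF T23(1) T2(3)]
      subsetD[OF T23(1) T2(4)] subsetD[OF T23(1) T2(6)]
    by (auto simp: target_def test_addr_def out_start_def)
  then have ex: "\<exists>is. length is \<le> (0 + 10 * N + 220 * N + 10 * N + 10 * N + 10 * N)
        + 2 * (Suc test_addr - input_len) \<and>
      (\<forall>r. \<forall>a<input_len. exec is r a = r a) \<and>
      (\<forall>r a. input_len \<le> a \<longrightarrow> a < Suc test_addr \<longrightarrow> exec is r a = target a r)"
    by (intro slp_le_compile_block[OF T(1)[unfolded S_def]])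
      (auto simp: test_addr_def out_start_def)
  have M3: "M3 \<le> 3 * N"
  proof -
    have "m * n * 1 \<le> m * n * (m + n)" using m by (intro mult_le_mono2) simp
    then show ?thesis unfolding dimM3_def dimM_def N_eq by linarith
  qed
  from ex obtain "is" where len: "length is \<le> (0 + 10 * N + 220 * N + 10 * N + 10 * N + 10 * N)
        + 2 * (Suc test_addr - input_len)"
    and code: "\<forall>r. \<forall>a<input_len. exec is r a = r a"
      "\<forall>r a. input_len \<le> a \<longrightarrow> a < Suc test_addr \<longrightarrow> exec is r a = target a r"
    by (elim exE conjE)
  \<comment> \<open>The stages use 260 N instructions and the copying 2 (3 N + M3 + 2), which is at
    most 16 N; 300 is rounded up.\<close>
  have "length is \<le> 300 * N"
    using len M3 Npos by (simp add: test_addr_def out_start_def)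
  then show ?thesis
    using code by (intro exI[of _ "is"]) (simp add: less_Suc_eq_le)
qed

end

section \<open>Execution of the loop on a run\<close>

context hot
begin

lemma load_hot_input:
  fixes \<epsilon> :: real
  defines "r \<equiv> load (hot_input \<sigma> \<epsilon> \<mu>1 \<mu>2 (y 0) (z 0) (x 0))"
  shows "r 0 = \<sigma>" "r 1 = \<epsilon>"
    "i < dimM m n \<Longrightarrow> r (2 + i) = \<mu>1 $ i" "i < dimM m n \<Longrightarrow> r (2 + (dimM m n + i)) = \<mu>2 $ i"
    "i < N \<Longrightarrow> r (2 + (dimM m n + (dimM m n + (M3 + i)))) = z 0 $ i"
    "i < N \<Longrightarrow> r (2 + (dimM m n + (dimM m n + (M3 + (N + i))))) = x 0 $ i"
    "r (2 + (dimM m n + (dimM m n + (M3 + (N + N)))) + j) = 0"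
proof -
  define V where "V = \<mu>1 @\<^sub>v \<mu>2 @\<^sub>v y 0 @\<^sub>v z 0 @\<^sub>v x 0"
  have dim: "dim_vec \<mu>1 = dimM m n" "dim_vec \<mu>2 = dimM m n" "dim_vec (y 0) = M3"
    using mu_carrier init_carrier by auto
  have V: "r (2 + i) = V $ i" if "i < dim_vec V" for i
    using that by (simp add: r_def load_def hot_input_def V_def[symmetric])
  show "r 0 = \<sigma>" "r 1 = \<epsilon>" by (simp_all add: r_def load_def hot_input_def)
  show "i < dimM m n \<Longrightarrow> r (2 + i) = \<mu>1 $ i"
    "i < dimM m n \<Longrightarrow> r (2 + (dimM m n + i)) = \<mu>2 $ i"
    "i < N \<Longrightarrow> r (2 + (dimM m n + (dimM m n + (M3 + i)))) = z 0 $ i"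
    "i < N \<Longrightarrow> r (2 + (dimM m n + (dimM m n + (M3 + (N + i))))) = x 0 $ i"
    by (subst V; simp add: V_def dim)+
  show "r (2 + (dimM m n + (dimM m n + (M3 + (N + N)))) + j) = 0"
    by (simp add: r_def load_def hot_input_def dim)
qed

interpretation C: hot_code m n
  by unfold_locales (rule m n)+

context
  fixes "is" :: "instr list" and \<epsilon> :: real
  assumes keep: "\<And>r a. a < C.input_len \<Longrightarrow> exec is r a = r a"
    and update: "\<And>r a. C.input_len \<le> a \<Longrightarrow> a \<le> C.test_addr \<Longrightarrow> exec is r a = C.target a r"
    and eps: "0 < \<epsilon>"
begin

abbreviation "inp \<equiv> hot_input \<sigma> \<epsilon> \<mu>1 \<mu>2 (y 0) (z 0) (x 0)"

text \<open>Memory before pass k, with passes counted from 0. The results of pass k are found in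
  \<open>state (Suc k)\<close>, which is what \<open>loop_state\<close> returns at k.\<close>

definition state :: "nat \<Rightarrow> nat \<Rightarrow> real" where
  "state k = (exec is ^^ k) (load inp)"

lemma state_Suc: "state (Suc k) = exec is (state k)"
  by (simp add: state_def)

lemma state_input: "a < C.input_len \<Longrightarrow> state k a = load inp a"
  by (induction k) (simp_all add: state_Suc keep, simp add: state_def)

lemma state_0: "state k 0 = \<sigma>" and state_1: "state k 1 = \<epsilon>"
  using state_input[of 0 k] state_input[of 1 k] load_hot_input(1,2)[where \<epsilon> = \<epsilon>]
  by (simp_all add: C.input_len_def)

lemma state_pass:
  assumes "\<forall>i<N. state k (C.input_len + i) = U k i - U 0 i"
  shows "i < N \<Longrightarrow> C.cur_u i (state k) = U k i"
    and "i < N \<Longrightarrow> C.xb i (state k) = xbar k $ i" and "i < N \<Longrightarrow> C.zb i (state k) = zbar k $ i"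
    and "i < N \<Longrightarrow> C.ub i (state k) = Ubar k i"
    and "r < M3 \<Longrightarrow> C.yb r (state k) = ybar k $ r"
    and "C.gapsq (state k) = (L2_set (gap k) {..<N})\<^sup>2"
proof -
  have cur: "C.cur_u i (state k) = U k i" if "i < N" for i
    using that assms state_0 load_hot_input(5,6)[where i = i and \<epsilon> = \<epsilon>]
    by (simp add: C.cur_u_def state_input C.input_len_def U_def)
  have mu: "C.mu1_reg i (state k) = \<mu>1 $ i" "C.mu2_reg i (state k) = \<mu>2 $ i"
    if "i < dimM m n" for i
    using that load_hot_input(3,4)[where i = i and \<epsilon> = \<epsilon>] by (simp_all add: C.mu1_reg_def C.mu2_reg_def state_input C.input_len_def)
  note correct = C.pass_correct[OF hot_axioms state_0 mu(1) mu(2) cur]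
  show "i < N \<Longrightarrow> C.cur_u i (state k) = U k i" by (rule cur)
  show "i < N \<Longrightarrow> C.xb i (state k) = xbar k $ i" by (rule correct)
  show "i < N \<Longrightarrow> C.zb i (state k) = zbar k $ i" by (rule correct)
  show "i < N \<Longrightarrow> C.ub i (state k) = Ubar k i" by (rule correct)
  show "r < M3 \<Longrightarrow> C.yb r (state k) = ybar k $ r" by (rule correct)
  show "C.gapsq (state k) = (L2_set (gap k) {..<N})\<^sup>2" by (rule correct)
qed

lemma state_invariant:
  "(\<forall>i<N. state k (C.input_len + i) = U k i - U 0 i) \<and> state k (C.input_len + N) = real k"
proof (induction k)
  case 0
  show ?case using load_hot_input(7)[where \<epsilon> = \<epsilon>] by (simp add: state_def C.input_len_def)
next
  case (Suc k)
  then have IH: "\<forall>i<N. state k (C.input_len + i) = U k i - U 0 i"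
    and count: "state k (C.input_len + N) = real k" by auto
  have addr: "C.input_len + N \<le> C.test_addr"
    by (simp add: C.test_addr_def C.out_start_def)
  have "state (Suc k) (C.input_len + i) = U (Suc k) i - U 0 i" if "i < N" for i
  proof -
    have "state (Suc k) (C.input_len + i) = C.next_v i (state k)"
      using that addr unfolding state_Suc by (subst update) (auto simp: C.target_def)
    also have "\<dots> = (real k + 1) / (real k + 2) * (2 * (Ubar k i - U k i) + (U k i - U 0 i))"
      using state_pass[OF IH] IH that by (simp add: C.next_v_def count)
    also have "\<dots> = U (Suc k) i - U 0 i"
    proof -
      define c where "c = (real k + 1) / (real k + 2)"
      have coeffs: "1 / real (k + 2) = 1 - c" "real (k + 1) / real (k + 2) = c"
        by (simp_all add: c_def field_simps)
      show ?thesis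
        unfolding step[OF that, of k] coeffs c_def[symmetric] by (simp add: algebra_simps)
    qed
    finally show ?thesis .
  qed
  moreover have "state (Suc k) (C.input_len + N) = real (Suc k)"
    using addr count unfolding state_Suc by (subst update) (auto simp: C.target_def)
  ultimately show ?case by simp
qed

lemmas state_values = state_pass[OF state_invariant[THEN conjunct1]]

lemma state_output:
  "map (state (Suc k)) [C.out_start..<C.test_addr] = list_of_vec (ybar k @\<^sub>v zbar k @\<^sub>v xbar k)"
proof (rule nth_equalityI)
  have dim: "dim_vec (ybar k) = M3" using ybar_carrier by auto
  show "length (map (state (Suc k)) [C.out_start..<C.test_addr])
      = length (list_of_vec (ybar k @\<^sub>v zbar k @\<^sub>v xbar k))"
    by (simp add: C.test_addr_def dim)
  fix i assume "i < length (map (state (Suc k)) [C.out_start..<C.test_addr])"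
  then have i: "i < M3 + (N + N)" by (simp add: C.test_addr_def)
  have "state (Suc k) (C.out_start + i) = C.target (C.out_start + i) (state k)"
    using i unfolding state_Suc
    by (intro update) (auto simp: C.test_addr_def C.out_start_def)
  also have "\<dots> = (ybar k @\<^sub>v zbar k @\<^sub>v xbar k) $ i"
    using i by (auto simp: C.target_def C.test_addr_def C.out_start_def dim state_values)
  also have "\<dots> = list_of_vec (ybar k @\<^sub>v zbar k @\<^sub>v xbar k) ! i"
    by (rule nth_list_of_vec[symmetric]) (use i in \<open>simp add: dim\<close>)
  finally show "map (state (Suc k)) [C.out_start..<C.test_addr] ! i
      = list_of_vec (ybar k @\<^sub>v zbar k @\<^sub>v xbar k) ! i"
    using i by (subst nth_map) (simp_all add: C.test_addr_def del: list_of_vec_append)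
qed

text \<open>The residual bound and \<epsilon> are nonnegative, so comparing squares compares the
  values.\<close>

lemma state_test_iff:
  "state (Suc k) C.test_addr \<le> 0 \<longleftrightarrow> (1 + \<sigma>) / \<sigma> * L2_set (gap k) {..<N} \<le> \<epsilon>"
proof -
  have "state (Suc k) C.test_addr = C.stop_value (state k)"
    unfolding state_Suc
    by (subst update) (auto simp: C.target_def C.test_addr_def C.out_start_def)
  also have "\<dots> = ((1 + \<sigma>) / \<sigma> * L2_set (gap k) {..<N})\<^sup>2 - \<epsilon>\<^sup>2"
    unfolding C.stop_value_def state_values(6) state_0 state_1 by (simp only: power_mult_distrib)
  finally show ?thesis
    using eps sigma by (simp only: diff_le_0_iff_le abs_le_square_iff[symmetric])
      (simp add: L2_set_nonneg)
qed

lemma loop_correct: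
  fixes P
  defines "P \<equiv> Loop [] is C.test_addr [C.out_start..<C.test_addr]"
    and "h \<equiv> hot_const \<sigma> (x 0) (z 0) xstar zstar"
  assumes len: "length is \<le> 300 * N"
  shows "loop_output P inp k = list_of_vec (ybar k @\<^sub>v zbar k @\<^sub>v xbar k)"
    and "\<exists>K. halts_after P inp K \<and>
      vnorm (kkt_residual m n \<mu>1 \<mu>2 (ybar K) (zbar K) (xbar K)) \<le> \<epsilon> \<and>
      real (loop_flops P K) \<le> 602 * max 1 (h / \<epsilon>) * real N"
proof -
  have state: "loop_state P inp k = state (Suc k)" for k
    by (simp add: loop_state_def P_def state_def)
  show "loop_output P inp k = list_of_vec (ybar k @\<^sub>v zbar k @\<^sub>v xbar k)"
    using state_output[of k] by (simp add: loop_output_def state) (simp add: P_def)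
  define stop where "stop k \<longleftrightarrow> (1 + \<sigma>) / \<sigma> * L2_set (gap k) {..<N} \<le> \<epsilon>" for k
  \<comment> \<open>The first pass whose test succeeds. It may come before the pass guaranteed by
    the rate, so that pass serves only as an upper bound.\<close>
  define K where "K = (LEAST k. stop k)"
  have bound: "stop (nat \<lceil>1 / \<epsilon> * h - 1\<rceil>)"
    unfolding stop_def h_def by (rule gap_le_tolerance[OF eps real_nat_ceiling_ge])
  have "stop K" unfolding K_def by (rule LeastI) (rule bound)
  moreover have "\<not> stop j" if "j < K" for j
    using that unfolding K_def by (rule not_less_Least)
  ultimately have "halts_after P inp K"
    unfolding halts_after_def state stop_def
    using state_test_iff by (auto simp: P_def not_le[symmetric])
  moreover have "vnorm (kkt_residual m n \<mu>1 \<mu>2 (ybar K) (zbar K) (xbar K)) \<le> \<epsilon>"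
    using residual_le_gap[of K] \<open>stop K\<close> unfolding stop_def by linarith
  moreover have "real (loop_flops P K) \<le> 602 * max 1 (h / \<epsilon>) * real N"
  proof -
    have "K \<le> nat \<lceil>1 / \<epsilon> * h - 1\<rceil>" unfolding K_def by (rule Least_le) (rule bound)
    moreover have "real (nat \<lceil>v\<rceil>) \<le> max 0 (v + 1)" for v :: real
      by (cases "0 \<le> \<lceil>v\<rceil>") (use ceiling_correct[of v] in auto)
    ultimately have "real K \<le> max 0 ((1 / \<epsilon> * h - 1) + 1)"
      using of_nat_le_iff order_trans by blast
    \<comment> \<open>There are K + 1 executed passes and K is at most max 0 (h / \<epsilon>); the
      factor 2 absorbs the additional pass.\<close>
    then have K: "real K + 1 \<le> 2 * max 1 (h / \<epsilon>)" by (auto simp: max_def split: if_splits)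
    have "1 \<le> N" using m n by (simp add: dimN_def Suc_le_eq)
    \<comment> \<open>The added 1 is the comparison charged at the end of each pass, absorbed into
      one more N.\<close>
    then have "real (length is + 1) \<le> 301 * real N" using len by linarith
    then have "real (K + 1) * real (length is + 1) \<le> (2 * max 1 (h / \<epsilon>)) * (301 * real N)"
      using K by (intro mult_mono) auto
    then show ?thesis by (simp add: loop_flops_def P_def algebra_simps)
  qed
  ultimately show "\<exists>K. halts_after P inp K \<and>
      vnorm (kkt_residual m n \<mu>1 \<mu>2 (ybar K) (zbar K) (xbar K)) \<le> \<epsilon> \<and>
      real (loop_flops P K) \<le> 602 * max 1 (h / \<epsilon>) * real N" by blast
qed

end

end

text \<open>The program is chosen before the data and depends only on m and n, while the constant is
  chosen before m and n. The maximum with 1 covers the pass that is executed even when the ratio of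
  \<open>hot_const\<close> to \<epsilon> is small.\<close>

theorem theorem1:
  shows "(\<forall>m n \<mu>1 \<mu>2 \<sigma> \<epsilon> y z x ybar zbar xbar xstar zstar.
       0 < m \<longrightarrow> 0 < n \<longrightarrow> 0 < \<epsilon> \<longrightarrow>
       hot_run m n \<mu>1 \<mu>2 \<sigma> y z x ybar zbar xbar xstar zstar \<longrightarrow>
         (\<forall>k. 1 / \<epsilon> * hot_const \<sigma> (x 0) (z 0) xstar zstar - 1 \<le> real k \<longrightarrow>
            vnorm (kkt_residual m n \<mu>1 \<mu>2 (ybar k) (zbar k) (xbar k)) \<le> \<epsilon>) \<and>
         (\<exists>k \<le> nat \<lceil>1 / \<epsilon> * hot_const \<sigma> (x 0) (z 0) xstar zstar - 1\<rceil>.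
            vnorm (kkt_residual m n \<mu>1 \<mu>2 (ybar k) (zbar k) (xbar k)) \<le> \<epsilon>)) \<and>
    (\<exists>C>0. \<forall>m n. 0 < m \<longrightarrow> 0 < n \<longrightarrow>
       (\<exists>P. \<forall>\<mu>1 \<mu>2 \<sigma> \<epsilon> y z x ybar zbar xbar xstar zstar.
          0 < \<epsilon> \<longrightarrow> hot_run m n \<mu>1 \<mu>2 \<sigma> y z x ybar zbar xbar xstar zstar \<longrightarrow>
            (\<forall>k. loop_output P (hot_input \<sigma> \<epsilon> \<mu>1 \<mu>2 (y 0) (z 0) (x 0)) k =
               list_of_vec (ybar k @\<^sub>v zbar k @\<^sub>v xbar k)) \<and>
            (\<exists>K. halts_after P (hot_input \<sigma> \<epsilon> \<mu>1 \<mu>2 (y 0) (z 0) (x 0)) K \<and>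
               vnorm (kkt_residual m n \<mu>1 \<mu>2 (ybar K) (zbar K) (xbar K)) \<le> \<epsilon> \<and>
               real (loop_flops P K) \<le>
                 C * max 1 (hot_const \<sigma> (x 0) (z 0) xstar zstar / \<epsilon>) * real (m^2 * n + m * n^2))))"
  (is "?rate \<and> ?complexity")
proof
  have residual: "vnorm (kkt_residual m n \<mu>1 \<mu>2 (ybar k) (zbar k) (xbar k)) \<le> \<epsilon>"
    if "0 < m" "0 < n" "0 < \<epsilon>" "hot_run m n \<mu>1 \<mu>2 \<sigma> y z x ybar zbar xbar xstar zstar"
      "1 / \<epsilon> * hot_const \<sigma> (x 0) (z 0) xstar zstar - 1 \<le> real k"
    for m n \<mu>1 \<mu>2 \<sigma> \<epsilon> y z x ybar zbar xbar xstar zstar k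
  proof -
    interpret hot m n \<mu>1 \<mu>2 \<sigma> y z x ybar zbar xbar xstar zstar
      using that by unfold_locales
    show ?thesis
      using residual_le_gap[of k] gap_le_tolerance[OF that(3,5)] by linarith
  qed
  then show ?rate by (blast intro: real_nat_ceiling_ge)
  have program: "\<exists>P. \<forall>\<mu>1 \<mu>2 \<sigma> \<epsilon> y z x ybar zbar xbar xstar zstar.
          0 < \<epsilon> \<longrightarrow> hot_run m n \<mu>1 \<mu>2 \<sigma> y z x ybar zbar xbar xstar zstar \<longrightarrow>
            (\<forall>k. loop_output P (hot_input \<sigma> \<epsilon> \<mu>1 \<mu>2 (y 0) (z 0) (x 0)) k =
               list_of_vec (ybar k @\<^sub>v zbar k @\<^sub>v xbar k)) \<and>
            (\<exists>K. halts_after P (hot_input \<sigma> \<epsilon> \<mu>1 \<mu>2 (y 0) (z 0) (x 0)) K \<and>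
               vnorm (kkt_residual m n \<mu>1 \<mu>2 (ybar K) (zbar K) (xbar K)) \<le> \<epsilon> \<and>
               real (loop_flops P K) \<le>
                 602 * max 1 (hot_const \<sigma> (x 0) (z 0) xstar zstar / \<epsilon>) * real (m^2 * n + m * n^2))"
    if pos: "0 < m" "0 < n" for m n
  proof -
    interpret C: hot_code m n using pos by unfold_locales
    obtain "is" where code: "length is \<le> 300 * dimN m n"
      "\<And>r a. a < C.input_len \<Longrightarrow> exec is r a = r a"
      "\<And>r a. C.input_len \<le> a \<Longrightarrow> a \<le> C.test_addr \<Longrightarrow> exec is r a = C.target a r"
      using C.body_exists by blast
    show ?thesis
    proof (intro exI[of _ "Loop [] is C.test_addr [C.out_start..<C.test_addr]"] allI impI)
      fix \<mu>1 \<mu>2 \<sigma> \<epsilon> y z x ybar zbar xbar xstar zstar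
      assume eps: "0 < (\<epsilon>::real)"
        and run: "hot_run m n \<mu>1 \<mu>2 \<sigma> y z x ybar zbar xbar xstar zstar"
      interpret hot m n \<mu>1 \<mu>2 \<sigma> y z x ybar zbar xbar xstar zstar
        using pos run by unfold_locales
      note correct = loop_correct[OF code(2,3) eps code(1)]
      show "(\<forall>k. loop_output (Loop [] is C.test_addr [C.out_start..<C.test_addr])
              (hot_input \<sigma> \<epsilon> \<mu>1 \<mu>2 (y 0) (z 0) (x 0)) k =
            list_of_vec (ybar k @\<^sub>v zbar k @\<^sub>v xbar k)) \<and>
          (\<exists>K. halts_after (Loop [] is C.test_addr [C.out_start..<C.test_addr])
              (hot_input \<sigma> \<epsilon> \<mu>1 \<mu>2 (y 0) (z 0) (x 0)) K \<and>
            vnorm (kkt_residual m n \<mu>1 \<mu>2 (ybar K) (zbar K) (xbar K)) \<le> \<epsilon> \<and>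
            real (loop_flops (Loop [] is C.test_addr [C.out_start..<C.test_addr]) K) \<le>
              602 * max 1 (hot_const \<sigma> (x 0) (z 0) xstar zstar / \<epsilon>) * real (m^2 * n + m * n^2))"
        using correct unfolding dimN_def by blast
    qed
  qed
  \<comment> \<open>602 is 2 times 301: twice the ratio for the number of passes, 301 N flops for
    each.\<close>
  then show ?complexity by (intro exI[of _ 602]) simp
qed

end
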